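(* Let $e$ and $m$ be positive integers. There exists a complete intersection numerical semigroup $\Gamma$ with embedding dimension $e(\Gamma)=e$ and multiplicity $m(\Gamma)=m$ if and only if $(e,m)=(1,1)$ or ($e\ge 2$ and $m\ge 2^{e-1}$). Equivalently, the set of pairs $(e(\Gamma),m(\Gamma))$, as $\Gamma$ ranges over all complete intersection numerical semigroups, is $$\{(1,1)\}\cup\{(e,m)\in\mathbb{Z}^2 : e\ge 2,\ m\ge 2^{e-1}\}.$$
   Context: $\mathbb{N}$ denotes the set of nonnegative integers. A numerical semigroup $\Gamma$ is an additive submonoid of $(\mathbb{N},+)$ (containing $0$) whose complement in $\mathbb{N}$ is finite; equivalently, $\Gamma=\langle A\rangle$ is the submonoid generated by a finite set $A\subset\mathbb{N}$ with $\gcd(A)=1$. Every numerical semigroup $\Gamma$ has a unique minimal generating set $\mathrm{Msg}(\Gamma)$. The embedding dimension is $e(\Gamma)=|\mathrm{Msg}(\Gamma)|$ and the multiplicity is $m(\Gamma)=\min(\Gamma\setminus\{0\})$. Let $\mathrm{Msg}(\Gamma)=\{a_1,\dots,a_n\}$. The monoid homomorphism $\varphi\colon\mathbb{N}^n\to\Gamma$, $(c_1,\dots,c_n)\mapsto c_1a_1+\cdots+c_na_n$, is surjective. A relation is a pair $(u,v)\in\mathbb{N}^n\times\mathbb{N}^n$ with $u_1a_1+\cdots+u_na_n=v_1a_1+\cdots+v_na_n$. The set of all relations is a congruence on the monoid $\mathbb{N}^n$ (an equivalence relation compatible with addition). A presentation of $\Gamma$ is a set of relations that generates this congruence, i.e.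 the smallest congruence on $\mathbb{N}^n$ containing it is the congruence of all relations. Let $\rho(\Gamma)$ be the minimum of the number of relations over all presentations of $\Gamma$. The numerical semigroup $\Gamma$ is called a complete intersection if $\rho(\Gamma)=e(\Gamma)-1$ (equivalently, the local semigroup ring $k[\![\Gamma]\!]$ over a field $k$ is a complete intersection ring). *)

theory Defs
  imports Main "HOL-Library.Extended_Nat" "HOL-Library.Function_Algebras"
begin

subsection \<open>Numerical semigroups\<close>

definition add_submonoid :: "nat set \<Rightarrow> bool" where
  "add_submonoid S \<longleftrightarrow> 0 \<in> S \<and> (\<forall>x\<in>S. \<forall>y\<in>S. x + y \<in> S)"

definition numerical_semigroup :: "nat set \<Rightarrow> bool" where
  "numerical_semigroup \<Gamma> \<longleftrightarrow> add_submonoid \<Gamma> \<and> finite (- \<Gamma>)"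

definition minimal_generating_set :: "nat set \<Rightarrow> nat set \<Rightarrow> bool" where
  "minimal_generating_set \<Gamma> A \<longleftrightarrow>
     add_submonoid hull A = \<Gamma> \<and> (\<forall>B. B \<subset> A \<longrightarrow> add_submonoid hull B \<noteq> \<Gamma>)"

text \<open>The description in \<open>Msg\<close> below is proper: every submonoid of the natural numbers has
  exactly one minimal generating set, namely the set of its irreducible elements.\<close>

lemma ex1_minimal_generating_set:
  assumes S: "add_submonoid S"
  shows "\<exists>!A. minimal_generating_set S A"
proof -
  define I where "I = {x \<in> S. x \<noteq> 0 \<and> (\<forall>y\<in>S. \<forall>z\<in>S. y \<noteq> 0 \<longrightarrow> z \<noteq> 0 \<longrightarrow> x \<noteq> y + z)}"
  have hull0: "0 \<in> add_submonoid hull A" for A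
    unfolding hull_def add_submonoid_def by auto
  have hull_add: "y + z \<in> add_submonoid hull A"
    if "y \<in> add_submonoid hull A" "z \<in> add_submonoid hull A" for y z A
    using that unfolding hull_def add_submonoid_def by auto
  have mem: "x \<in> add_submonoid hull I" if "x \<in> S" for x
    using that
  proof (induction x rule: less_induct)
    case (less x)
    show ?case
    proof (cases "x = 0 \<or> x \<in> I")
      case True
      then show ?thesis
        using hull0[of I] subsetD[OF hull_subset[of I add_submonoid]] by metis
    next
      case False
      then obtain y z where yz: "y \<in> S" "z \<in> S" "y \<noteq> 0" "z \<noteq> 0" "x = y + z"
        using less.prems unfolding I_def by blast
      then have "y \<in> add_submonoid hull I" "z \<in> add_submonoid hull I"
        using less.IH by auto
      then show ?thesis
        using hull_add yz(5) by simp
    qed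
  qed
  have "I \<subseteq> S"
    by (auto simp: I_def)
  then have gen: "add_submonoid hull I = S"
    using hull_minimal[of I S add_submonoid] S mem by (simp add: subset_antisym subsetI)
  have sub: "I \<subseteq> A" if A: "add_submonoid hull A = S" for A
  proof
    fix x assume x: "x \<in> I"
    show "x \<in> A"
    proof (rule ccontr)
      assume "x \<notin> A"
      moreover have "A \<subseteq> S"
        using hull_subset[of A add_submonoid] A by simp
      ultimately have "A \<subseteq> S - {x}"
        by blast
      moreover have "y + z \<noteq> x" if "y \<in> S - {x}" "z \<in> S - {x}" for y z
      proof (cases "y = 0 \<or> z = 0")
        case False
        with x that show ?thesis
          unfolding I_def by blast
      qed (use that in auto)
      then have "add_submonoid (S - {x})"
        using S x unfolding add_submonoid_def by (simp add: I_def)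
      ultimately have "add_submonoid hull A \<subseteq> S - {x}"
        by (rule hull_minimal)
      then show False
        using A x \<open>I \<subseteq> S\<close> by blast
    qed
  qed
  show ?thesis
  proof (rule ex1I[of _ I])
    show "minimal_generating_set S I"
      unfolding minimal_generating_set_def using gen sub by (meson leD)
  next
    fix A assume A: "minimal_generating_set S A"
    then have "I \<subseteq> A"
      using sub by (simp add: minimal_generating_set_def)
    moreover have "\<not> I \<subset> A"
      using A gen unfolding minimal_generating_set_def by metis
    ultimately show "A = I"
      by (simp add: psubset_eq)
  qed
qed

definition Msg :: "nat set \<Rightarrow> nat set" where
  "Msg \<Gamma> = (THE A. minimal_generating_set \<Gamma> A)"

definition embedding_dim :: "nat set \<Rightarrow> nat" where
  "embedding_dim \<Gamma> = card (Msg \<Gamma>)"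

definition multiplicity_ns :: "nat set \<Rightarrow> nat" where
  "multiplicity_ns \<Gamma> = (LEAST x. x \<in> \<Gamma> - {0})"


subsection \<open>Presentations\<close>

text \<open>For \<open>A = {a\<^sub>1, \<dots>, a\<^sub>n}\<close>, the coordinates of \<open>\<nat>\<^sup>n\<close> are indexed by the generators themselves:
  \<open>expvec A\<close> consists of the functions \<open>u\<close> vanishing off \<open>A\<close>, the coordinate \<open>u\<^sub>i\<close> being \<open>u a\<^sub>i\<close>.
  Addition of such vectors is pointwise.\<close>

definition expvec :: "nat set \<Rightarrow> (nat \<Rightarrow> nat) set" where
  "expvec A = {u. \<forall>a. a \<notin> A \<longrightarrow> u a = 0}"

definition phi :: "nat set \<Rightarrow> (nat \<Rightarrow> nat) \<Rightarrow> nat" where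
  "phi A u = (\<Sum>a\<in>A. u a * a)"

definition relations :: "nat set \<Rightarrow> ((nat \<Rightarrow> nat) \<times> (nat \<Rightarrow> nat)) set" where
  "relations A = {(u, v). u \<in> expvec A \<and> v \<in> expvec A \<and> phi A u = phi A v}"

definition congruence :: "nat set \<Rightarrow> ((nat \<Rightarrow> nat) \<times> (nat \<Rightarrow> nat)) set \<Rightarrow> bool" where
  "congruence A C \<longleftrightarrow> equiv (expvec A) C \<and>
     (\<forall>u v u' v'. (u, v) \<in> C \<longrightarrow> (u', v') \<in> C \<longrightarrow> (u + u', v + v') \<in> C)"

definition presentation :: "nat set \<Rightarrow> ((nat \<Rightarrow> nat) \<times> (nat \<Rightarrow> nat)) set \<Rightarrow> bool" where
  "presentation \<Gamma> R \<longleftrightarrow>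
     R \<subseteq> relations (Msg \<Gamma>) \<and> congruence (Msg \<Gamma>) hull R = relations (Msg \<Gamma>)"

text \<open>The number of relations is counted in \<open>enat\<close>, so that infinite presentations count as
  \<open>\<infinity>\<close> (and not as \<open>0\<close>, as \<^const>\<open>card\<close> would have it). The infimum of a nonempty set of
  extended naturals is attained, hence a minimum.\<close>

definition num_relations :: "'a set \<Rightarrow> enat" where
  "num_relations R = (if finite R then enat (card R) else \<infinity>)"

definition rho :: "nat set \<Rightarrow> enat" where
  "rho \<Gamma> = (INF R\<in>{R. presentation \<Gamma> R}. num_relations R)"

definition complete_intersection :: "nat set \<Rightarrow> bool" where
  "complete_intersection \<Gamma> \<longleftrightarrow>
     numerical_semigroup \<Gamma> \<and> rho \<Gamma> = enat (embedding_dim \<Gamma> - 1)"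

end

theory Submission
  imports Defs Complex_Main "HOL-Library.Multiset" "HOL-Library.Poly_Mapping" "HOL-Number_Theory.Cong"
begin

text \<open>
  Let \<open>\<Gamma>\<close> be a complete intersection with minimal generators \<open>A\<close>, \<open>card A = e\<close>, and let \<open>m\<close> be its
  multiplicity, which belongs to \<open>A\<close>. Put \<open>r = e - 1\<close>.

  Necessity of \<open>m \<ge> 2 ^ r\<close> is the inequality between the length of an Artinian complete intersection
  and the product of the orders of its equations, obtained by counting dimensions. Take a presentation
  with \<open>r\<close> relations; each relation \<open>(u, v)\<close> gives a polynomial \<open>x ^ u - x ^ v\<close>, which is considered after
  setting the variable \<open>x\<^sub>m\<close> to \<open>0\<close>. Minimality of the generators forces these \<open>r\<close> polynomials to have
  order at least \<open>2\<close> (\<open>relation_total_ge_2\<close>). The quotient of the polynomial ring in the \<open>r\<close> remaining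
  variables by the ideal \<open>J\<close> they generate is spanned by one monomial for each element of the Apery set
  of \<open>m\<close>, hence by at most \<open>m\<close> monomials (\<open>red_monom_reduce\<close>). Applying this
  repeatedly, the quotient by \<open>J ^ s\<close> is spanned by the products of such a monomial with fewer than \<open>s\<close>
  of the \<open>r\<close> polynomials (\<open>red_monom_in_span\<close>). Since \<open>J ^ s\<close> has order at least \<open>2 * s\<close>, the monomials
  of degree less than \<open>2 * s\<close> remain independent modulo \<open>J ^ s\<close>. Comparing the two numbers
  (\<open>card_small_le\<close>) yields \<open>(2 * s - 1 + r choose r) \<le> m * (s - 1 + r choose r)\<close>, and the
  quotient of these two binomial coefficients tends to \<open>2 ^ r\<close> as \<open>s\<close> grows
  (\<open>two_power_le_of_binomial_growth\<close>).

  For sufficiency, let \<open>S\<close> be a complete intersection, \<open>d \<ge> 2\<close>, and \<open>c\<close> a nonzero element of \<open>S\<close>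
  prime to \<open>d\<close> that is not a minimal generator. Then \<open>d S + c \<nat>\<close> is again a complete intersection
  (\<open>complete_intersection_glue\<close>): one generator \<open>c\<close> is new, and so is one relation, which
  rewrites \<open>d\<close> copies of \<open>c\<close> by means of a factorization of \<open>c\<close> in \<open>S\<close>. Its multiplicity is
  the minimum of \<open>c\<close> and \<open>d\<close> times that of \<open>S\<close>. Taking \<open>c = m\<close> and \<open>d = m + 1\<close> gives multiplicity
  \<open>m\<close>, provided that there is an \<open>S\<close> of embedding dimension \<open>e - 1\<close> containing \<open>m\<close> as a
  non-generator. Such an \<open>S\<close> of multiplicity \<open>2 ^ (e - 2)\<close> is built by gluing with \<open>d = 2\<close>
  (\<open>ex_complete_intersection_two_power\<close>).

  That presentations have at least \<open>e - 1\<close> relations (\<open>card_Msg_le_presentation\<close>) reduces being a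
  complete intersection to the existence of a presentation with at most \<open>e - 1\<close> relations.
\<close>

section \<open>Generators and exponent vectors\<close>

definition axis :: "nat \<Rightarrow> nat \<Rightarrow> nat \<Rightarrow> nat" where
  "axis a n = (\<lambda>x. if x = a then n else 0)"

lemma axis_in_expvec: "a \<in> A \<Longrightarrow> axis a n \<in> expvec A"
  by (auto simp: axis_def expvec_def)

lemma zero_in_expvec: "0 \<in> expvec A"
  by (auto simp: expvec_def)

lemma add_in_expvec: "u \<in> expvec A \<Longrightarrow> v \<in> expvec A \<Longrightarrow> u + v \<in> expvec A"
  by (auto simp: expvec_def)

lemma phi_add: "phi A (u + v) = phi A u + phi A v"
  by (simp add: phi_def sum.distrib algebra_simps)

lemma phi_zero: "phi A 0 = 0"
  by (simp add: phi_def)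

lemma phi_axis: "finite A \<Longrightarrow> a \<in> A \<Longrightarrow> phi A (axis a n) = n * a"
  by (simp add: phi_def axis_def if_distrib[of "\<lambda>x. x * _"] sum.delta cong: if_cong)

lemma expvec_split_axis:
  assumes "u \<in> expvec A" "u a > 0"
  obtains w where "w \<in> expvec A" "u = w + axis a 1"
proof
  show "u(a := u a - 1) \<in> expvec A"
    using assms by (auto simp: expvec_def)
  show "u = u(a := u a - 1) + axis a 1"
    using assms by (auto simp: axis_def fun_eq_iff)
qed

lemma expvec_nonzero:
  assumes "u \<in> expvec A" "u \<noteq> 0"
  obtains a where "a \<in> A" "u a > 0"
proof -
  from \<open>u \<noteq> 0\<close> obtain a where "u a \<noteq> 0" by (auto simp: fun_eq_iff)
  moreover from this have "a \<in> A" using assms(1) by (auto simp: expvec_def)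
  ultimately show ?thesis using that[of a] by simp
qed

lemma phi_eq_0:
  assumes "finite A" "0 \<notin> A" "u \<in> expvec A" "phi A u = 0"
  shows "u = 0"
proof (rule ccontr)
  assume "u \<noteq> 0"
  then obtain a where "a \<in> A" "u a > 0"
    using expvec_nonzero assms(3) by blast
  then show False
    using assms by (auto simp: phi_def)
qed

lemma add_submonoidI:
  "0 \<in> S \<Longrightarrow> (\<And>x y. x \<in> S \<Longrightarrow> y \<in> S \<Longrightarrow> x + y \<in> S) \<Longrightarrow> add_submonoid S"
  by (simp add: add_submonoid_def)

lemma add_submonoid_0: "add_submonoid S \<Longrightarrow> 0 \<in> S"
  by (simp add: add_submonoid_def)

lemma add_submonoid_add: "add_submonoid S \<Longrightarrow> x \<in> S \<Longrightarrow> y \<in> S \<Longrightarrow> x + y \<in> S"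
  by (simp add: add_submonoid_def)

lemma add_submonoid_hull: "add_submonoid (add_submonoid hull A)"
  unfolding hull_def add_submonoid_def by auto

lemma add_submonoid_mult:
  assumes "add_submonoid S" "x \<in> S" shows "n * x \<in> S"
  using assms by (induction n) (auto simp: add_submonoid_def)

lemma phi_mem:
  assumes "add_submonoid S" "A \<subseteq> S" shows "phi A u \<in> S"
proof -
  have "(\<Sum>a\<in>B. u a * a) \<in> S" if "B \<subseteq> A" for B
    using that
  proof (induction B rule: infinite_finite_induct)
    case (insert a B)
    then have "u a * a \<in> S"
      using add_submonoid_mult[OF assms(1)] assms(2) by blast
    then show ?case using insert assms(1) by (auto simp: add_submonoid_def)
  qed (use assms(1) in \<open>auto simp: add_submonoid_def\<close>)
  then show ?thesis by (simp add: phi_def)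
qed

lemma hull_eq_phi_image:
  assumes "finite A"
  shows "add_submonoid hull A = phi A ` expvec A"
proof
  have "a \<in> phi A ` expvec A" if "a \<in> A" for a
    by (rule image_eqI[of _ _ "axis a 1"]) (use that assms in \<open>auto simp: phi_axis axis_in_expvec\<close>)
  moreover have "add_submonoid (phi A ` expvec A)"
    unfolding add_submonoid_def
    by (auto simp flip: phi_add intro!: imageI add_in_expvec)
       (metis image_eqI phi_zero zero_in_expvec)
  ultimately show "add_submonoid hull A \<subseteq> phi A ` expvec A"
    by (intro hull_minimal) auto
  show "phi A ` expvec A \<subseteq> add_submonoid hull A"
    using phi_mem[OF add_submonoid_hull hull_subset] by auto
qed

definition irreducible_in :: "nat set \<Rightarrow> nat \<Rightarrow> bool" where
  "irreducible_in S a \<longleftrightarrow>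
     a \<in> S \<and> a \<noteq> 0 \<and> (\<forall>y\<in>S. \<forall>z\<in>S. a = y + z \<longrightarrow> y = 0 \<or> z = 0)"

lemma irreducible_in_add:
  "irreducible_in S (y + z) \<Longrightarrow> y \<in> S \<Longrightarrow> z \<in> S \<Longrightarrow> y = 0 \<or> z = 0"
  by (simp add: irreducible_in_def)

text \<open>If an irreducible element \<open>a\<close> were missing from the generators, these would all lie in the
  submonoid obtained by deleting \<open>a\<close>.\<close>

lemma irreducible_in_generators:
  assumes "irreducible_in (add_submonoid hull A) a"
  shows "a \<in> A"
proof (rule ccontr)
  let ?S = "add_submonoid hull A"
  assume "a \<notin> A"
  then have "A \<subseteq> ?S - {a}"
    using hull_subset[of A add_submonoid] by blast
  moreover have "add_submonoid (?S - {a})"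
  proof (rule add_submonoidI)
    show "0 \<in> ?S - {a}"
      using assms add_submonoid_hull[of A] by (simp add: irreducible_in_def add_submonoid_def)
    fix x y assume xy: "x \<in> ?S - {a}" "y \<in> ?S - {a}"
    have "x + y \<in> ?S"
      using xy add_submonoid_hull[of A] unfolding add_submonoid_def by blast
    moreover have "x + y \<noteq> a"
    proof
      assume "x + y = a"
      then have "x = 0 \<or> y = 0" using xy assms unfolding irreducible_in_def by blast
      then show False using xy \<open>x + y = a\<close> by auto
    qed
    ultimately show "x + y \<in> ?S - {a}" by blast
  qed
  ultimately have "?S \<subseteq> ?S - {a}"
    by (rule hull_minimal)
  then show False using assms by (auto simp: irreducible_in_def)
qed

lemma minimal_generating_set_Msg:
  "add_submonoid S \<Longrightarrow> minimal_generating_set S (Msg S)"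
  unfolding Msg_def by (rule theI') (rule ex1_minimal_generating_set)

lemma hull_Msg: "add_submonoid S \<Longrightarrow> add_submonoid hull Msg S = S"
  using minimal_generating_set_Msg by (simp add: minimal_generating_set_def)

lemma Msg_eqI:
  assumes "add_submonoid S" "add_submonoid hull A = S" "\<And>a. a \<in> A \<Longrightarrow> irreducible_in S a"
  shows "Msg S = A"
proof -
  have "minimal_generating_set S A"
    unfolding minimal_generating_set_def
    using assms irreducible_in_generators by (metis psubsetD psubset_imp_ex_mem DiffE)
  then show ?thesis
    using minimal_generating_set_Msg[OF assms(1)] ex1_minimal_generating_set[OF assms(1)] by blast
qed

text \<open>A generator that splits into two smaller elements is redundant: the two summands are
  generated without it.\<close>

lemma Msg_irreducible:
  assumes S: "add_submonoid S" and a: "a \<in> Msg S"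
  shows "irreducible_in S a"
proof (rule ccontr)
  assume red: "\<not> irreducible_in S a"
  define A where "A = Msg S"
  have A: "add_submonoid hull A = S" "\<And>B. B \<subset> A \<Longrightarrow> add_submonoid hull B \<noteq> S"
    using minimal_generating_set_Msg[OF S] by (auto simp: minimal_generating_set_def A_def)
  let ?T = "add_submonoid hull (A - {a})"
  \<comment> \<open>An element of \<open>S\<close> smaller than \<open>a\<close> cannot involve \<open>a\<close>.\<close>
  have small: "x \<in> ?T" if "x \<in> S" "x < a" for x
  proof -
    have "add_submonoid {x. x \<ge> a \<or> x \<in> ?T}"
      using add_submonoid_hull[of "A - {a}"] by (auto simp: add_submonoid_def)
    moreover have "A \<subseteq> {x. x \<ge> a \<or> x \<in> ?T}"
      using hull_subset[of "A - {a}" add_submonoid] by auto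
    ultimately have "S \<subseteq> {x. x \<ge> a \<or> x \<in> ?T}"
      using hull_minimal[of A _ add_submonoid] A(1) by metis
    then show ?thesis using that by auto
  qed
  have "a \<in> S"
    using a A(1) hull_subset[of A add_submonoid] by (auto simp: A_def)
  have "a \<in> ?T"
  proof (cases "a = 0")
    case True
    then show ?thesis using add_submonoid_hull[of "A - {a}"] by (auto simp: add_submonoid_def)
  next
    case False
    with red \<open>a \<in> S\<close> obtain y z where "y \<in> S" "z \<in> S" "a = y + z" "y \<noteq> 0" "z \<noteq> 0"
      by (auto simp: irreducible_in_def)
    then show ?thesis
      using small[of y] small[of z] add_submonoid_hull[of "A - {a}"] by (auto simp: add_submonoid_def)
  qed
  then have "A \<subseteq> ?T"
    using hull_subset[of "A - {a}" add_submonoid] by auto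
  then have "S \<subseteq> ?T"
    using hull_minimal[of A ?T add_submonoid] add_submonoid_hull A(1) by simp
  moreover have "?T \<subseteq> S"
    using hull_mono[of "A - {a}" A add_submonoid] A(1) by auto
  ultimately show False
    using A(2)[of "A - {a}"] a by (auto simp: A_def)
qed

lemma Msg_iff_irreducible:
  assumes "add_submonoid S"
  shows "a \<in> Msg S \<longleftrightarrow> irreducible_in S a"
  using Msg_irreducible[OF assms] irreducible_in_generators[of "Msg S"] hull_Msg[OF assms] by auto

lemma numerical_semigroup_eventually:
  assumes "numerical_semigroup S"
  obtains N where "\<And>x. x \<ge> N \<Longrightarrow> x \<in> S"
proof -
  have "finite (- S)" using assms by (simp add: numerical_semigroup_def)
  then obtain N where "\<forall>x\<in>-S. x < N"
    using finite_nat_set_iff_bounded by auto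
  then show ?thesis using that[of N] by (meson ComplI leD)
qed

lemma numerical_semigroupI:
  assumes "add_submonoid S" "\<And>x. x \<ge> N \<Longrightarrow> x \<in> S"
  shows "numerical_semigroup S"
proof -
  have "- S \<subseteq> {..<N}" using assms(2) by (auto simp: not_le[symmetric])
  then show ?thesis
    using assms(1) finite_subset by (auto simp: numerical_semigroup_def)
qed

lemma multiplicity_ns_Least:
  assumes "numerical_semigroup S"
  shows "multiplicity_ns S \<in> S" "multiplicity_ns S > 0"
    "\<And>x. x \<in> S \<Longrightarrow> x > 0 \<Longrightarrow> multiplicity_ns S \<le> x"
proof -
  obtain N where N: "\<And>x. x \<ge> N \<Longrightarrow> x \<in> S"
    using numerical_semigroup_eventually[OF assms] by metis
  have "Suc N \<in> S - {0}" using N[of "Suc N"] by simp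
  then have "multiplicity_ns S \<in> S - {0}"
    unfolding multiplicity_ns_def by (rule LeastI)
  then show "multiplicity_ns S \<in> S" "multiplicity_ns S > 0" by auto
  show "multiplicity_ns S \<le> x" if "x \<in> S" "x > 0" for x
    unfolding multiplicity_ns_def using that by (intro Least_le) auto
qed

lemma multiplicity_in_Msg:
  assumes "numerical_semigroup S" shows "multiplicity_ns S \<in> Msg S"
proof -
  note m = multiplicity_ns_Least[OF assms]
  have "irreducible_in S (multiplicity_ns S)"
    unfolding irreducible_in_def
  proof (intro conjI ballI impI)
    fix y z assume yz: "y \<in> S" "z \<in> S" "multiplicity_ns S = y + z"
    show "y = 0 \<or> z = 0"
      using m(3)[OF yz(1)] m(3)[OF yz(2)] yz(3) by linarith
  qed (use m in auto)
  then show ?thesis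
    using assms by (simp add: Msg_iff_irreducible numerical_semigroup_def)
qed

text \<open>Finiteness of the set of generators and the bound on the Apery set both come from this
  pigeonhole argument: elements of one residue class differ by a multiple of \<open>m\<close>.\<close>

lemma inj_on_mod:
  fixes X :: "nat set"
  assumes "\<And>a k. a \<in> X \<Longrightarrow> a + Suc k * m \<notin> X"
  shows "inj_on (\<lambda>a. a mod m) X"
proof -
  have neq: "a mod m \<noteq> b mod m" if "a \<in> X" "b \<in> X" "a < b" for a b
  proof
    assume "a mod m = b mod m"
    then obtain k where k: "b = a + k * m"
      using \<open>a < b\<close> by (metis less_imp_le_nat mod_eq_nat1E mult.commute)
    then obtain j where "k = Suc j" using \<open>a < b\<close> by (cases k) auto
    then show False using assms[OF \<open>a \<in> X\<close>, of j] k \<open>b \<in> X\<close> by simp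
  qed
  show ?thesis
  proof (rule inj_onI)
    fix a b assume "a \<in> X" "b \<in> X" "a mod m = b mod m"
    then show "a = b" using neq[of a b] neq[of b a] by (cases a b rule: linorder_cases) auto
  qed
qed

lemma finite_Msg:
  assumes "numerical_semigroup S" shows "finite (Msg S)"
proof -
  let ?m = "multiplicity_ns S"
  note m = multiplicity_ns_Least[OF assms]
  have S: "add_submonoid S" using assms by (simp add: numerical_semigroup_def)
  have "inj_on (\<lambda>a. a mod ?m) (Msg S)"
  proof (rule inj_on_mod)
    fix a k assume a: "a \<in> Msg S"
    have "irreducible_in S a" using a S by (simp add: Msg_iff_irreducible)
    moreover have "Suc k * ?m \<in> S" using add_submonoid_mult[OF S m(1)] .
    moreover have "Suc k * ?m \<noteq> 0" using m(2) by simp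
    ultimately have "\<not> irreducible_in S (a + Suc k * ?m)"
      using irreducible_in_add[of S a "Suc k * ?m"] by (auto simp: irreducible_in_def[of S a])
    then show "a + Suc k * ?m \<notin> Msg S"
      using S by (simp add: Msg_iff_irreducible)
  qed
  moreover have "(\<lambda>a. a mod ?m) ` Msg S \<subseteq> {..<?m}"
    using m(2) by auto
  ultimately show ?thesis
    using finite_imageD finite_subset by blast
qed

section \<open>Presentations\<close>

lemma congruenceI:
  assumes "equiv (expvec A) C"
    and "\<And>u v u' v'. (u, v) \<in> C \<Longrightarrow> (u', v') \<in> C \<Longrightarrow> (u + u', v + v') \<in> C"
  shows "congruence A C"
  using assms by (simp add: congruence_def)

lemma relations_congruence: "congruence A (relations A)"
  unfolding congruence_def
proof (intro conjI equivI)
  show "relations A \<subseteq> expvec A \<times> expvec A" by (auto simp: relations_def)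
qed (auto simp: relations_def phi_add add_in_expvec intro!: refl_onI symI transI)

lemma hull_congruence:
  assumes "R \<subseteq> relations A"
  shows "congruence A (congruence A hull R)"
proof -
  let ?H = "congruence A hull R"
  have H: "x \<in> ?H \<longleftrightarrow> (\<forall>C. congruence A C \<and> R \<subseteq> C \<longrightarrow> x \<in> C)" for x
    by (auto simp: hull_def)
  have sub: "?H \<subseteq> relations A"
    using hull_minimal[of R "relations A" "congruence A"] assms relations_congruence by blast
  show ?thesis
  proof (intro congruenceI equivI)
    show "?H \<subseteq> expvec A \<times> expvec A" using sub by (auto simp: relations_def)
    show "refl_on (expvec A) ?H"
      by (rule refl_onI) (auto simp: H congruence_def equiv_def refl_on_def)
    show "sym ?H"
      by (rule symI) (auto simp: H congruence_def equiv_def dest: symD)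
    show "trans ?H"
      by (rule transI) (auto simp: H congruence_def equiv_def dest: transD)
    show "(u + u', v + v') \<in> ?H" if "(u, v) \<in> ?H" "(u', v') \<in> ?H" for u v u' v'
      using that by (auto simp: H congruence_def)
  qed
qed

text \<open>All uses of a presentation take the following form: a property of pairs that is a congruence
  and holds for the given relations holds for every relation.\<close>

lemma presentation_subset_congruence:
  assumes "presentation S R" "congruence (Msg S) C" "R \<subseteq> C"
  shows "relations (Msg S) \<subseteq> C"
  using assms hull_minimal[of R C "congruence (Msg S)"] by (auto simp: presentation_def)

lemma presentationI:
  assumes "R \<subseteq> relations (Msg S)"
    and "\<And>C. congruence (Msg S) C \<Longrightarrow> R \<subseteq> C \<Longrightarrow> relations (Msg S) \<subseteq> C"
  shows "presentation S R"
  unfolding presentation_def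
  using assms hull_congruence[OF assms(1)] hull_subset[of R "congruence (Msg S)"]
    hull_minimal[of R "relations (Msg S)" "congruence (Msg S)"] relations_congruence by blast

section \<open>Finitely supported functions as a vector space\<close>

interpretation pm: vector_space "\<lambda>(c::real) (p :: 'b \<Rightarrow>\<^sub>0 real). Poly_Mapping.map ((*) c) p"
proof
  fix a b :: real and x y :: "'b \<Rightarrow>\<^sub>0 real"
  have lm: "Poly_Mapping.lookup (Poly_Mapping.map ((*) c) p) k = c * Poly_Mapping.lookup p k"
    for c and p :: "'b \<Rightarrow>\<^sub>0 real" and k
    by (simp add: Poly_Mapping.map.rep_eq when_def)
  show "Poly_Mapping.map ((*) a) (x + y) = Poly_Mapping.map ((*) a) x + Poly_Mapping.map ((*) a) y"
    by (intro poly_mapping_eqI) (simp add: lm lookup_add algebra_simps)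
  show "Poly_Mapping.map ((*) (a + b)) x = Poly_Mapping.map ((*) a) x + Poly_Mapping.map ((*) b) x"
    by (intro poly_mapping_eqI) (simp add: lm lookup_add algebra_simps)
  show "Poly_Mapping.map ((*) a) (Poly_Mapping.map ((*) b) x) = Poly_Mapping.map ((*) (a * b)) x"
    by (intro poly_mapping_eqI) (simp add: lm)
  show "Poly_Mapping.map ((*) 1) x = x"
    by (intro poly_mapping_eqI) (simp add: lm)
qed

lemma lookup_scale [simp]: "Poly_Mapping.lookup (Poly_Mapping.map ((*) c) p) k = (c::real) * Poly_Mapping.lookup p k"
  by (simp add: Poly_Mapping.map.rep_eq when_def)

lemma scale_single: "Poly_Mapping.map ((*) (c::real)) (Poly_Mapping.single k x) = Poly_Mapping.single k (c * x)"
  by (intro poly_mapping_eqI) (simp add: lookup_single when_def)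

text \<open>The dimension count shared by the two lower bounds below: a space containing the unit vectors
  of \<open>I\<close> needs at least \<open>card I\<close> spanning vectors.\<close>

lemma card_le_of_singles_in_span:
  assumes "finite I" "finite F"
    and "\<And>i. i \<in> I \<Longrightarrow> Poly_Mapping.single i (1::real) \<in> pm.span F"
  shows "card I \<le> card F"
proof -
  let ?s = "\<lambda>i. Poly_Mapping.single i (1::real)"
  have inj: "inj_on ?s I"
    by (rule inj_onI) (metis keys_single one_neq_zero the_elem_eq)
  have "pm.independent (?s ` I)"
  proof (rule pm.independent_if_scalars_zero)
    show "finite (?s ` I)" using assms(1) by simp
    fix f :: "('a \<Rightarrow>\<^sub>0 real) \<Rightarrow> real" and x
    assume 0: "(\<Sum>x\<in>?s ` I. Poly_Mapping.map ((*) (f x)) x) = 0" and "x \<in> ?s ` I"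
    then obtain i where i: "i \<in> I" "x = ?s i" by auto
    have "0 = Poly_Mapping.lookup (\<Sum>j\<in>I. Poly_Mapping.map ((*) (f (?s j))) (?s j)) i"
      using 0 inj by (simp add: sum.reindex del: map_single)
    also have "\<dots> = (\<Sum>j\<in>I. if j = i then f (?s j) else 0)"
      by (auto simp: lookup_sum lookup_single when_def intro!: sum.cong)
    also have "\<dots> = f x"
      using i assms(1) by simp
    finally show "f x = 0" by simp
  qed
  moreover have "?s ` I \<subseteq> pm.span F"
    using assms(3) by auto
  ultimately have "card (?s ` I) \<le> card F"
    using pm.independent_span_bound[OF assms(2)] by blast
  then show ?thesis
    using inj by (simp add: card_image)
qed

lemma map_span_subset:
  fixes f :: "('b \<Rightarrow>\<^sub>0 real) \<Rightarrow> ('c \<Rightarrow>\<^sub>0 real)"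
  assumes "\<And>x y. f (x + y) = f x + f y"
    and "\<And>c x. f (Poly_Mapping.map ((*) c) x) = Poly_Mapping.map ((*) c) (f x)"
    and "\<And>x. x \<in> G \<Longrightarrow> f x \<in> pm.span H" and "p \<in> pm.span G"
  shows "f p \<in> pm.span H"
proof -
  have "f 0 = 0" using assms(1)[of 0 0] by simp
  from assms(4) show ?thesis
  proof (induction rule: pm.span_induct_alt)
    case base
    show ?case using \<open>f 0 = 0\<close> by (simp add: pm.span_zero)
  next
    case (step c x y)
    then show ?case
      using assms(1-3) by (simp add: pm.span_add pm.span_scale)
  qed
qed

section \<open>Every presentation has at least \<open>e - 1\<close> relations\<close>

text \<open>The vector \<open>u - v\<close> with its coordinates outside \<open>B\<close> dropped. Below, \<open>B\<close> omits one generator \<open>m\<close>;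
  for a relation the omitted coordinate is determined by the others.\<close>

definition diff_vec :: "nat set \<Rightarrow> (nat \<Rightarrow> nat) \<Rightarrow> (nat \<Rightarrow> nat) \<Rightarrow> (nat \<Rightarrow>\<^sub>0 real)" where
  "diff_vec B u v = (\<Sum>b\<in>B. Poly_Mapping.single b (real (u b) - real (v b)))"

text \<open>Pairs whose difference lies in the span of the differences of the given relations form a
  congruence. Hence the differences of a presentation span those of all relations, a space of
  dimension \<open>e - 1\<close>.\<close>

lemma card_Msg_le_presentation:
  assumes S: "numerical_semigroup S" and R: "presentation S R" "finite R"
  shows "card (Msg S) - 1 \<le> card R"
proof -
  define A where "A = Msg S"
  define m where "m = multiplicity_ns S"
  define B where "B = A - {m}"
  have fin: "finite A" "finite B" and m: "m \<in> A" "m > 0"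
    using finite_Msg[OF S] multiplicity_in_Msg[OF S] multiplicity_ns_Least[OF S]
    by (auto simp: A_def m_def B_def)
  define D where "D = (\<lambda>(u, v). diff_vec B u v) ` R"
  define C where "C = {(u, v). u \<in> expvec A \<and> v \<in> expvec A \<and> diff_vec B u v \<in> pm.span D}"
  have self: "diff_vec B u u = 0" for u
    by (simp add: diff_vec_def)
  have swap: "diff_vec B v u = - diff_vec B u v" for u v
    by (simp add: diff_vec_def sum_negf[symmetric] single_uminus[symmetric])
  have comp: "diff_vec B u w = diff_vec B u v + diff_vec B v w" for u v w
    by (simp add: diff_vec_def sum.distrib[symmetric] single_add[symmetric])
  have add: "diff_vec B (u + u') (v + v') = diff_vec B u v + diff_vec B u' v'" for u v u' v'
    by (simp add: diff_vec_def sum.distrib[symmetric] single_add[symmetric] algebra_simps)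
  have "congruence A C"
  proof (intro congruenceI equivI)
    show "C \<subseteq> expvec A \<times> expvec A" by (auto simp: C_def)
    show "refl_on (expvec A) C"
      by (rule refl_onI) (simp add: C_def self pm.span_zero)
    show "sym C"
    proof (rule symI)
      fix u v assume "(u, v) \<in> C"
      then show "(v, u) \<in> C"
        using pm.span_neg[of "diff_vec B u v" D] swap[of v u] by (simp add: C_def)
    qed
    show "trans C"
    proof (rule transI)
      fix u v w assume "(u, v) \<in> C" "(v, w) \<in> C"
      then show "(u, w) \<in> C"
        using pm.span_add[of "diff_vec B u v" D "diff_vec B v w"] comp[of u w v] by (simp add: C_def)
    qed
    show "(u + u', v + v') \<in> C" if "(u, v) \<in> C" "(u', v') \<in> C" for u v u' v'
      using that by (auto simp: C_def add add_in_expvec intro: pm.span_add)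
  qed
  moreover have "R \<subseteq> C"
    using R(1) by (auto simp: presentation_def relations_def A_def C_def D_def intro!: pm.span_base)
  ultimately have rel: "relations A \<subseteq> C"
    using presentation_subset_congruence[OF R(1)] by (simp add: A_def)
  have "Poly_Mapping.single b 1 \<in> pm.span D" if b: "b \<in> B" for b
  proof -
    \<comment> \<open>In the coordinates of \<open>B\<close>, the trivial relation \<open>m \<cdot> b = b \<cdot> m\<close> is a multiple of a unit vector.\<close>
    have "(axis b m, axis m b) \<in> relations A"
      using b m fin by (auto simp: relations_def axis_in_expvec phi_axis B_def)
    then have "diff_vec B (axis b m) (axis m b) \<in> pm.span D"
      using rel by (auto simp: C_def)
    moreover have "diff_vec B (axis b m) (axis m b) = Poly_Mapping.single b (real m)"
    proof -
      have "diff_vec B (axis b m) (axis m b) = (\<Sum>c\<in>B. if c = b then Poly_Mapping.single b (real m) else 0)"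
        unfolding diff_vec_def by (intro sum.cong) (auto simp: axis_def B_def)
      then show ?thesis using b fin by simp
    qed
    ultimately have "Poly_Mapping.map ((*) (1 / real m)) (Poly_Mapping.single b (real m)) \<in> pm.span D"
      using pm.span_scale by metis
    then show ?thesis
      using m by (simp add: scale_single)
  qed
  then have "card B \<le> card D"
    using card_le_of_singles_in_span[of B D] fin R(2) by (simp add: D_def)
  also have "\<dots> \<le> card R"
    unfolding D_def by (rule card_image_le) fact
  finally show ?thesis
    using m fin by (simp add: B_def A_def)
qed

text \<open>The infimum defining \<^const>\<open>rho\<close> is attained, because \<^typ>\<open>enat\<close> is well-ordered.\<close>

lemma complete_intersection_iff:
  "complete_intersection S \<longleftrightarrow> numerical_semigroup S \<and>
     (\<exists>R. presentation S R \<and> finite R \<and> card R \<le> card (Msg S) - 1)"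
proof (cases "numerical_semigroup S")
  case True
  let ?P = "{R. presentation S R}"
  have attained: "Inf X \<in> X" if "X \<noteq> {}" for X :: "enat set"
    using that unfolding Inf_enat_def by (auto intro: LeastI)
  have lower: "enat (card (Msg S) - 1) \<le> num_relations R" if "R \<in> ?P" for R
    using card_Msg_le_presentation[OF True, of R] that by (simp add: num_relations_def)
  have "rho S = enat (card (Msg S) - 1) \<longleftrightarrow>
          (\<exists>R. presentation S R \<and> finite R \<and> card R \<le> card (Msg S) - 1)"
  proof
    assume rho: "rho S = enat (card (Msg S) - 1)"
    have "?P \<noteq> {}"
    proof
      assume "?P = {}"
      then have "rho S = \<infinity>" by (simp add: rho_def top_enat_def)
      then show False using rho by simp
    qed
    then have "rho S \<in> num_relations ` ?P"
      unfolding rho_def by (intro attained) auto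
    then obtain R where "presentation S R" "num_relations R = enat (card (Msg S) - 1)"
      using rho by auto
    then show "\<exists>R. presentation S R \<and> finite R \<and> card R \<le> card (Msg S) - 1"
      by (auto simp: num_relations_def split: if_splits)
  next
    assume "\<exists>R. presentation S R \<and> finite R \<and> card R \<le> card (Msg S) - 1"
    then obtain R where R: "presentation S R" "finite R" "card R \<le> card (Msg S) - 1" by blast
    show "rho S = enat (card (Msg S) - 1)"
    proof (rule antisym)
      show "rho S \<le> enat (card (Msg S) - 1)"
        unfolding rho_def by (rule INF_lower2[of R]) (use R in \<open>auto simp: num_relations_def\<close>)
      show "enat (card (Msg S) - 1) \<le> rho S"
        unfolding rho_def by (rule INF_greatest) (rule lower)
    qed
  qed
  then show ?thesis
    using True by (simp add: complete_intersection_def embedding_dim_def)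
qed (simp add: complete_intersection_def)

section \<open>Multisets of bounded size and the growth of binomial coefficients\<close>

text \<open>These multisets index both the monomials of bounded degree and the products of boundedly many
  given polynomials.\<close>

definition small_multisets :: "'a set \<Rightarrow> nat \<Rightarrow> 'a multiset set" where
  "small_multisets A n = {M. set_mset M \<subseteq> A \<and> size M < n}"

lemma small_multisets_Suc:
  "small_multisets A (Suc n) = small_multisets A n \<union> multisets_of_size A n"
  by (auto simp: small_multisets_def multisets_of_size_def less_Suc_eq)

lemma finite_small_multisets:
  "finite A \<Longrightarrow> finite (small_multisets A n)"
proof (induction n)
  case 0 then show ?case by (simp add: small_multisets_def)
next
  case (Suc n) then show ?case
    by (simp add: small_multisets_Suc finite_multisets_of_size)
qed

lemma card_small_multisets:
  assumes "finite A"
  shows "card (small_multisets A (Suc t)) = (card A + t) choose card A"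
proof -
  have step: "card (small_multisets A (Suc n)) = card (small_multisets A n) + (card A + n - 1 choose n)" for n
  proof -
    have "small_multisets A n \<inter> multisets_of_size A n = {}"
      by (auto simp: small_multisets_def multisets_of_size_def)
    then show ?thesis
      using assms
      by (simp add: small_multisets_Suc card_Un_disjoint finite_small_multisets
          finite_multisets_of_size card_multisets_of_size)
  qed
  have "card (small_multisets A (Suc t)) = (card A + t) choose t"
  proof (induction t)
    case 0
    have "small_multisets A 0 = {}" by (simp add: small_multisets_def)
    then show ?case using step[of 0] by simp
  next
    case (Suc t)
    then show ?case using step[of "Suc t"] by simp
  qed
  then show ?thesis
    using binomial_symmetric[of t "card A + t"] by simp
qed

text \<open>Multiplied by \<open>r!\<close>, the left side is at least \<open>(2 (t + 1)) ^ r\<close>, while the right side is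
  \<open>m (t + 1) ^ r\<close> times a product of \<open>r\<close> factors \<open>1 + i / (t + 1)\<close>, which tend to \<open>1\<close>.\<close>

lemma two_power_le_of_binomial_growth:
  assumes "\<And>t. ((r + (2 * t + 1)) choose r) \<le> m * ((r + t) choose r)"
  shows "2 ^ r \<le> m"
proof -
  have binom: "real ((r + t) choose r) * fact r = (\<Prod>i<r. real t + 1 + real i)" for t
    by (simp add: binomial_gbinomial gbinomial_pochhammer' pochhammer_prod atLeast0LessThan)
  have "(\<Prod>i<r. 2::real) \<le> real m * (\<Prod>i<r. 1 + real i / real (Suc t))" for t
  proof -
    have "(\<Prod>i<r. 2 * real (Suc t)) \<le> (\<Prod>i<r. real (2 * t + 1) + 1 + real i)"
      by (rule prod_mono) auto
    also have "\<dots> = real ((r + (2 * t + 1)) choose r) * fact r"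
      by (rule binom[symmetric])
    also have "\<dots> \<le> real (m * ((r + t) choose r)) * fact r"
      using assms[of t] by (intro mult_right_mono of_nat_mono) auto
    also have "\<dots> = real m * (\<Prod>i<r. real t + 1 + real i)"
      by (simp add: binom[symmetric])
    also have "(\<Prod>i<r. real t + 1 + real i) = (\<Prod>i<r. (1 + real i / real (Suc t)) * real (Suc t))"
      by (intro prod.cong) (auto simp: field_simps)
    finally have "(\<Prod>i<r. 2::real) * real (Suc t) ^ r
        \<le> real m * (\<Prod>i<r. 1 + real i / real (Suc t)) * real (Suc t) ^ r"
      unfolding prod.distrib by (simp only: prod_constant card_lessThan mult.assoc)
    then show ?thesis
      by (rule mult_right_le_imp_le) simp
  qed
  moreover have "(\<lambda>t. real m * (\<Prod>i<r. 1 + real i / real (Suc t))) \<longlonglongrightarrow> real m * (\<Prod>i<r. 1 + 0)"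
  proof (intro tendsto_intros)
    show "(\<lambda>t. real i / real (Suc t)) \<longlonglongrightarrow> 0" for i
      using LIMSEQ_Suc[OF lim_const_over_n[of "real i"]] by simp
  qed
  ultimately have "(\<Prod>i<r. 2::real) \<le> real m * (\<Prod>i<r. 1 + 0)"
    by (intro LIMSEQ_le_const) auto
  then have "real (2 ^ r) \<le> real m" by simp
  then show ?thesis by (simp only: of_nat_le_iff)
qed

section \<open>The multiplicity bound\<close>

definition total :: "nat set \<Rightarrow> (nat \<Rightarrow> nat) \<Rightarrow> nat" where
  "total A u = (\<Sum>a\<in>A. u a)"

lemma total_add: "total A (u + v) = total A u + total A v"
  by (simp add: total_def sum.distrib)

type_synonym poly = "(nat \<Rightarrow> nat) \<Rightarrow>\<^sub>0 real"

definition order_ge :: "nat set \<Rightarrow> nat \<Rightarrow> poly \<Rightarrow> bool" where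
  "order_ge A k p \<longleftrightarrow> (\<forall>u\<in>Poly_Mapping.keys p. k \<le> total A u)"

lemma order_ge_mult:
  assumes "order_ge A k p" "order_ge A l q"
  shows "order_ge A (k + l) (p * q)"
  unfolding order_ge_def
proof
  fix u assume "u \<in> Poly_Mapping.keys (p * q)"
  then obtain v w where "u = v + w" "v \<in> Poly_Mapping.keys p" "w \<in> Poly_Mapping.keys q"
    using keys_mult by blast
  then show "k + l \<le> total A u"
    using assms by (auto simp: order_ge_def total_add intro!: add_mono)
qed

lemma order_ge_prod_mset:
  assumes "\<And>x. x \<in># M \<Longrightarrow> order_ge A k (f x)"
  shows "order_ge A (k * size M) (prod_mset (image_mset f M))"
  using assms
proof (induction M)
  case empty
  show ?case by (simp add: order_ge_def)
next
  case (add x M)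
  then have "order_ge A (k + k * size M) (f x * prod_mset (image_mset f M))"
    by (intro order_ge_mult) auto
  then show ?case by (simp add: mult_ac)
qed

text \<open>A vector of total degree \<open>1\<close> is the factorization of a single generator; since generators are
  irreducible, no other vector has the same value, so such vectors occur in trivial relations only.\<close>

lemma relation_total_ge_2:
  assumes "add_submonoid S" "finite (Msg S)" "(u, v) \<in> relations (Msg S)" "u \<noteq> v"
  shows "total (Msg S) u \<ge> 2"
proof (rule ccontr)
  define A where "A = Msg S"
  have uv: "u \<in> expvec A" "v \<in> expvec A" "phi A u = phi A v" and fin: "finite A"
    using assms by (auto simp: relations_def A_def)
  have irr: "irreducible_in S a" if "a \<in> A" for a
    using that Msg_irreducible[OF assms(1)] by (simp add: A_def)
  then have "0 \<notin> A" "A \<subseteq> S" by (auto simp: irreducible_in_def)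
  note phi0 = phi_eq_0[OF fin \<open>0 \<notin> A\<close>]
  assume "\<not> total (Msg S) u \<ge> 2"
  then have small: "total A u \<le> 1" by (simp add: A_def)
  have "u \<noteq> 0"
  proof
    assume "u = 0"
    then have "v = 0" using phi0 uv by (simp add: phi_zero)
    then show False using \<open>u = 0\<close> assms(4) by simp
  qed
  then obtain a where a: "a \<in> A" "u a > 0"
    using expvec_nonzero uv(1) by blast
  then obtain w where w: "w \<in> expvec A" "u = w + axis a 1"
    using expvec_split_axis uv(1) by blast
  have "total A (axis a 1) = 1"
    using a fin by (simp add: total_def axis_def)
  then have "total A w = 0" using small w(2) by (simp add: total_add)
  then have "w = 0" using w(1) fin by (fastforce simp: total_def expvec_def)
  then have u: "u = axis a 1" using w(2) by simp
  then have phiv: "phi A v = a" using uv(3) phi_axis[OF fin a(1), of 1] by simp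
  have "a \<noteq> 0" using a(1) \<open>0 \<notin> A\<close> by metis
  then have "v \<noteq> 0" using phiv by (auto simp: phi_zero)
  then obtain b where b: "b \<in> A" "v b > 0"
    using expvec_nonzero uv(2) by blast
  then obtain w' where w': "w' \<in> expvec A" "v = w' + axis b 1"
    using expvec_split_axis uv(2) by blast
  have "a = phi A w' + b"
    using phiv w'(2) phi_axis[OF fin b(1), of 1] by (simp add: phi_add)
  moreover have "phi A w' \<in> S" "b \<in> S" "b \<noteq> 0"
    using phi_mem[OF assms(1) \<open>A \<subseteq> S\<close>] irr[OF b(1)] by (auto simp: irreducible_in_def)
  ultimately have "phi A w' = 0"
    using irr[OF a(1)] by (auto simp: irreducible_in_def)
  then have "w' = 0" using phi0 w'(1) by blast
  then have "v = axis b 1" "a = b"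
    using w'(2) \<open>a = phi A w' + b\<close> \<open>phi A w' = 0\<close> by auto
  then show False using u assms(4) by simp
qed

locale presented_semigroup =
  fixes S :: "nat set" and R :: "((nat \<Rightarrow> nat) \<times> (nat \<Rightarrow> nat)) set" and m :: nat
  assumes S: "numerical_semigroup S" and pres: "presentation S R" and fin_R: "finite R"
    and m: "m \<in> Msg S"
begin

text \<open>The image of the monomial \<open>x ^ u\<close> after setting the variable \<open>x\<^sub>m\<close> to \<open>0\<close>.\<close>

definition red_monom :: "(nat \<Rightarrow> nat) \<Rightarrow> poly" where
  "red_monom u = (if u m = 0 then Poly_Mapping.single u 1 else 0)"

definition rel_binom :: "(nat \<Rightarrow> nat) \<times> (nat \<Rightarrow> nat) \<Rightarrow> poly" where
  "rel_binom \<rho> = red_monom (fst \<rho>) - red_monom (snd \<rho>)"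

definition rel_prod :: "((nat \<Rightarrow> nat) \<times> (nat \<Rightarrow> nat)) multiset \<Rightarrow> poly" where
  "rel_prod \<alpha> = prod_mset (image_mset rel_binom \<alpha>)"

text \<open>The Apery set of \<open>m\<close>; the quantifier expresses \<open>w - m \<notin> S\<close> without subtraction.\<close>

definition apery :: "nat set" where
  "apery = {w \<in> S. \<forall>x\<in>S. w \<noteq> x + m}"

definition rep :: "nat \<Rightarrow> nat \<Rightarrow> nat" where
  "rep w = (SOME u. u \<in> expvec (Msg S) \<and> phi (Msg S) u = w)"

lemma submonoid: "add_submonoid S"
  using S by (simp add: numerical_semigroup_def)

lemma fin: "finite (Msg S)"
  using S by (rule finite_Msg)

lemma Msg_pos: "a \<in> Msg S \<Longrightarrow> a > 0" and Msg_subset: "Msg S \<subseteq> S"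
  using Msg_irreducible[OF submonoid] by (auto simp: irreducible_in_def)

lemma S_eq: "S = phi (Msg S) ` expvec (Msg S)"
  using hull_Msg[OF submonoid] hull_eq_phi_image[OF fin] by simp

lemma rep:
  assumes "w \<in> S" shows "rep w \<in> expvec (Msg S)" "phi (Msg S) (rep w) = w"
proof -
  have "\<exists>u. u \<in> expvec (Msg S) \<and> phi (Msg S) u = w"
    using assms equalityD1[OF S_eq] by blast
  from someI_ex[OF this] show "rep w \<in> expvec (Msg S)" "phi (Msg S) (rep w) = w"
    by (auto simp: rep_def)
qed

lemma apery_finite_card: "finite apery" "card apery \<le> m"
proof -
  have m0: "m > 0" "m \<in> S" using m Msg_pos Msg_subset by auto
  have inj: "inj_on (\<lambda>a. a mod m) apery"
  proof (rule inj_on_mod)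
    fix a k assume "a \<in> apery"
    then have "a + k * m \<in> S"
      using add_submonoid_mult[OF submonoid m0(2)] add_submonoid_add[OF submonoid]
      by (simp add: apery_def)
    moreover have "a + Suc k * m = (a + k * m) + m" by simp
    ultimately show "a + Suc k * m \<notin> apery" unfolding apery_def by blast
  qed
  have sub: "(\<lambda>a. a mod m) ` apery \<subseteq> {..<m}"
    using m0 by auto
  show "finite apery"
    using finite_imageD[OF _ inj] sub finite_subset by blast
  show "card apery \<le> m"
    using card_inj_on_le[OF inj sub] by simp
qed

lemma red_monom_add: "red_monom (u + v) = red_monom u * red_monom v"
  by (simp add: red_monom_def mult_single)

lemma span_mult:
  assumes "\<And>g. g \<in> G \<Longrightarrow> q * g \<in> pm.span H" and "p \<in> pm.span G"
  shows "q * p \<in> pm.span (H :: poly set)"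
proof (rule map_span_subset[where f = "(*) q"])
  show "q * Poly_Mapping.map ((*) c) x = Poly_Mapping.map ((*) c) (q * x)" for c and x :: poly
    by (simp add: mult_map_scale_conv_mult mult_ac)
qed (use assms in \<open>auto simp: algebra_simps\<close>)

text \<open>Spanning vectors, over the reals, of the ideal \<open>J\<close> generated by the relation polynomials in the
  variables different from \<open>x\<^sub>m\<close>.\<close>

definition ideal_gens :: "poly set" where
  "ideal_gens = {rel_binom \<rho> * red_monom u | \<rho> u. \<rho> \<in> R \<and> u \<in> expvec (Msg S)}"

text \<open>Congruence of monomials modulo an ideal is a congruence of exponent vectors, so it suffices to
  look at the relations of the presentation.\<close>

lemma relation_in_ideal:
  assumes "(u, v) \<in> relations (Msg S)"
  shows "red_monom u - red_monom v \<in> pm.span ideal_gens"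
proof -
  define C where "C = {(u, v). u \<in> expvec (Msg S) \<and> v \<in> expvec (Msg S) \<and>
    red_monom u - red_monom v \<in> pm.span ideal_gens}"
  have mult: "red_monom w * p \<in> pm.span ideal_gens"
    if "p \<in> pm.span ideal_gens" "w \<in> expvec (Msg S)" for p w
  proof (rule span_mult[OF _ that(1)])
    fix g assume "g \<in> ideal_gens"
    then obtain \<rho> u where g: "g = rel_binom \<rho> * red_monom u" "\<rho> \<in> R" "u \<in> expvec (Msg S)"
      by (auto simp: ideal_gens_def)
    have "red_monom w * g = rel_binom \<rho> * red_monom (w + u)"
      by (simp add: g(1) red_monom_add mult_ac)
    then show "red_monom w * g \<in> pm.span ideal_gens"
      using g(2,3) that(2) add_in_expvec unfolding ideal_gens_def by (intro pm.span_base) blast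
  qed
  have "congruence (Msg S) C"
  proof (intro congruenceI equivI)
    show "C \<subseteq> expvec (Msg S) \<times> expvec (Msg S)" by (auto simp: C_def)
    show "refl_on (expvec (Msg S)) C"
      by (rule refl_onI) (simp add: C_def pm.span_zero)
    show "sym C"
    proof (rule symI)
      fix u v assume "(u, v) \<in> C"
      then show "(v, u) \<in> C"
        using pm.span_neg[of "red_monom u - red_monom v" ideal_gens] by (simp add: C_def)
    qed
    show "trans C"
    proof (rule transI)
      fix u v w assume "(u, v) \<in> C" "(v, w) \<in> C"
      then show "(u, w) \<in> C"
        using pm.span_add[of "red_monom u - red_monom v" ideal_gens "red_monom v - red_monom w"]
        by (simp add: C_def)
    qed
    fix u v u' v' assume uv: "(u, v) \<in> C" "(u', v') \<in> C"
    \<comment> \<open>The product rule for differences.\<close>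
    have "red_monom (u + u') - red_monom (v + v') =
        red_monom u' * (red_monom u - red_monom v) + red_monom v * (red_monom u' - red_monom v')"
      by (simp add: red_monom_add algebra_simps)
    also have "\<dots> \<in> pm.span ideal_gens"
      using uv by (intro pm.span_add mult) (auto simp: C_def)
    finally show "(u + u', v + v') \<in> C"
      using uv by (auto simp: C_def add_in_expvec)
  qed
  moreover have "R \<subseteq> C"
  proof (rule subrelI)
    fix u v assume uv: "(u, v) \<in> R"
    have "rel_binom (u, v) * red_monom 0 \<in> pm.span ideal_gens"
      using uv zero_in_expvec by (intro pm.span_base) (auto simp: ideal_gens_def)
    moreover have "red_monom 0 = 1" by (simp add: red_monom_def)
    ultimately show "(u, v) \<in> C"
      using uv pres by (auto simp: C_def rel_binom_def presentation_def relations_def)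
  qed
  ultimately have "relations (Msg S) \<subseteq> C"
    using presentation_subset_congruence[OF pres] by simp
  then show ?thesis using assms by (auto simp: C_def)
qed

text \<open>Modulo \<open>J\<close>, a monomial depends on its value \<open>w\<close> in \<open>S\<close> only. If \<open>w\<close> is outside the Apery set, it has
  a factorization involving \<open>m\<close>, and the monomial of that factorization was set to \<open>0\<close>.\<close>

lemma red_monom_reduce:
  assumes v: "v \<in> expvec (Msg S)"
  shows "red_monom v \<in> pm.span ((\<lambda>w. red_monom (rep w)) ` apery \<union> ideal_gens)"
proof -
  let ?G = "(\<lambda>w. red_monom (rep w)) ` apery \<union> ideal_gens"
  have ideal: "p \<in> pm.span ?G" if "p \<in> pm.span ideal_gens" for p
    using that pm.span_mono[of ideal_gens ?G] by auto
  define w where "w = phi (Msg S) v"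
  have "w \<in> S"
    unfolding w_def using phi_mem[OF submonoid Msg_subset] .
  show ?thesis
  proof (cases "w \<in> apery")
    case True
    have "(v, rep w) \<in> relations (Msg S)"
      using v rep[OF \<open>w \<in> S\<close>] by (simp add: relations_def w_def)
    then have "red_monom v - red_monom (rep w) \<in> pm.span ?G"
      using relation_in_ideal ideal by blast
    moreover have "red_monom (rep w) \<in> pm.span ?G"
      using True by (intro pm.span_base) auto
    ultimately show ?thesis
      using pm.span_add by fastforce
  next
    case False
    then obtain x where x: "x \<in> S" "w = x + m"
      using \<open>w \<in> S\<close> by (auto simp: apery_def)
    have "(v, rep x + axis m 1) \<in> relations (Msg S)"
      using v rep[OF x(1)] x(2) m phi_axis[OF fin m, of 1]
      by (simp add: relations_def w_def phi_add add_in_expvec axis_in_expvec)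
    then have "red_monom v - red_monom (rep x + axis m 1) \<in> pm.span ?G"
      using relation_in_ideal ideal by blast
    moreover have "red_monom (rep x + axis m 1) = 0"
      by (simp add: red_monom_def axis_def)
    ultimately show ?thesis by simp
  qed
qed

text \<open>The vectors in \<open>power_gens s\<close> span \<open>J ^ s\<close>; modulo \<open>J ^ s\<close>, the finitely many vectors in
  \<open>std_gens s\<close> turn out to span all polynomials.\<close>

definition std_gens :: "nat \<Rightarrow> poly set" where
  "std_gens s = (\<lambda>(\<alpha>, w). rel_prod \<alpha> * red_monom (rep w)) ` (small_multisets R s \<times> apery)"

definition power_gens :: "nat \<Rightarrow> poly set" where
  "power_gens s = {rel_prod \<alpha> * red_monom u | \<alpha> u. \<alpha> \<in> multisets_of_size R s \<and> u \<in> expvec (Msg S)}"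

text \<open>A product of \<open>s\<close> relation polynomials with a monomial is rewritten by reducing the monomial
  modulo \<open>J\<close>: the Apery part has only \<open>s\<close> factors and is kept, the remaining part gains another
  factor from \<open>J\<close>.\<close>

lemma red_monom_in_span:
  "v \<in> expvec (Msg S) \<Longrightarrow> red_monom v \<in> pm.span (std_gens s \<union> power_gens s)"
proof (induction s)
  case 0
  then have "red_monom v \<in> power_gens 0"
    by (auto simp: power_gens_def rel_prod_def)
  then show ?case by (simp add: pm.span_base)
next
  case (Suc s)
  let ?T = "pm.span (std_gens (Suc s) \<union> power_gens (Suc s))"
  have "std_gens s \<union> power_gens s \<subseteq> ?T"
  proof
    fix g assume "g \<in> std_gens s \<union> power_gens s"
    then show "g \<in> ?T"
    proof
      assume "g \<in> std_gens s"
      then have "g \<in> std_gens (Suc s)"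
        by (auto simp: std_gens_def small_multisets_Suc)
      then show ?thesis by (simp add: pm.span_base)
    next
      assume "g \<in> power_gens s"
      then obtain \<alpha> u where g: "g = rel_prod \<alpha> * red_monom u"
        and \<alpha>: "\<alpha> \<in> multisets_of_size R s" and u: "u \<in> expvec (Msg S)"
        by (auto simp: power_gens_def)
      show ?thesis
        unfolding g
      proof (rule span_mult[OF _ red_monom_reduce[OF u]])
        fix h assume "h \<in> (\<lambda>w. red_monom (rep w)) ` apery \<union> ideal_gens"
        then show "rel_prod \<alpha> * h \<in> ?T"
        proof
          assume "h \<in> (\<lambda>w. red_monom (rep w)) ` apery"
          then have "rel_prod \<alpha> * h \<in> std_gens (Suc s)"
            using \<alpha> by (auto simp: std_gens_def small_multisets_Suc)
          then show ?thesis by (simp add: pm.span_base)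
        next
          assume "h \<in> ideal_gens"
          then obtain \<rho> u' where h: "h = rel_binom \<rho> * red_monom u'" "\<rho> \<in> R" "u' \<in> expvec (Msg S)"
            by (auto simp: ideal_gens_def)
          have "rel_prod \<alpha> * h = rel_prod (add_mset \<rho> \<alpha>) * red_monom u'"
            by (simp add: h(1) rel_prod_def mult_ac)
          moreover have "add_mset \<rho> \<alpha> \<in> multisets_of_size R (Suc s)"
            using \<alpha> h(2) by (auto simp: multisets_of_size_def)
          ultimately have "rel_prod \<alpha> * h \<in> power_gens (Suc s)"
            using h(3) unfolding power_gens_def by blast
          then show ?thesis by (simp add: pm.span_base)
        qed
      qed
    qed
  qed
  then have "pm.span (std_gens s \<union> power_gens s) \<subseteq> ?T"
    by (rule pm.span_minimal) (rule pm.subspace_span)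
  then show ?case using Suc by blast
qed

lemma order_ge_rel_binom:
  assumes "\<rho> \<in> R" shows "order_ge (Msg S) 2 (rel_binom \<rho>)"
proof -
  obtain u v where \<rho>: "\<rho> = (u, v)" by (cases \<rho>)
  have uv: "(u, v) \<in> relations (Msg S)" "(v, u) \<in> relations (Msg S)"
    using assms pres \<rho> by (auto simp: presentation_def relations_def)
  show ?thesis
  proof (cases "u = v")
    case False
    have "Poly_Mapping.keys (rel_binom \<rho>) \<subseteq> {u, v}"
      unfolding \<rho> by (auto simp: rel_binom_def red_monom_def in_keys_iff lookup_minus lookup_single when_def split: if_splits)
    moreover have "total (Msg S) u \<ge> 2" "total (Msg S) v \<ge> 2"
      using relation_total_ge_2[OF submonoid fin] uv False by auto
    ultimately show ?thesis by (auto simp: order_ge_def)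
  qed (simp add: \<rho> rel_binom_def order_ge_def)
qed

lemma order_ge_power_gens:
  assumes "g \<in> power_gens s" shows "order_ge (Msg S) (2 * s) g"
proof -
  obtain \<alpha> u where g: "g = rel_prod \<alpha> * red_monom u" and \<alpha>: "\<alpha> \<in> multisets_of_size R s"
    using assms by (auto simp: power_gens_def)
  have "order_ge (Msg S) (2 * size \<alpha>) (rel_prod \<alpha>)"
    unfolding rel_prod_def using \<alpha>
    by (intro order_ge_prod_mset order_ge_rel_binom) (auto simp: multisets_of_size_def)
  moreover have "order_ge (Msg S) 0 (red_monom u)"
    by (simp add: order_ge_def)
  ultimately show ?thesis
    using order_ge_mult[of _ _ "rel_prod \<alpha>" 0 "red_monom u"] \<alpha> g
    by (auto simp: multisets_of_size_def)
qed

text \<open>Discarding all terms outside the monomials in the variables other than \<open>x\<^sub>m\<close> of degree less than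
  \<open>2 * s\<close> is linear and kills \<open>J ^ s\<close>, so those monomials are spanned by the images of
  \<^term>\<open>std_gens s\<close>.\<close>

lemma card_small_le:
  "card (small_multisets (Msg S - {m}) (2 * s)) \<le> m * card (small_multisets R s)"
proof -
  let ?B = "Msg S - {m}"
  define D where "D = count ` small_multisets ?B (2 * s)"
  define trunc :: "poly \<Rightarrow> poly"
    where "trunc p = (\<Sum>u\<in>D. Poly_Mapping.single u (Poly_Mapping.lookup p u))" for p
  have finD: "finite D"
    using fin by (simp add: D_def finite_small_multisets)
  have D: "u \<in> expvec (Msg S)" "u m = 0" "total (Msg S) u < 2 * s" if u: "u \<in> D" for u
  proof -
    obtain M where M: "u = count M" "set_mset M \<subseteq> ?B" "size M < 2 * s"
      using u by (auto simp: D_def small_multisets_def)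
    show "u \<in> expvec (Msg S)" "u m = 0"
      using M by (auto simp: expvec_def count_eq_zero_iff subset_eq)
    have "total (Msg S) u = size M"
      unfolding M(1) total_def size_multiset_overloaded_eq
      using M(2) fin by (intro sum.mono_neutral_right) (auto simp: count_eq_zero_iff)
    then show "total (Msg S) u < 2 * s" using M(3) by simp
  qed
  have trunc_add: "trunc (p + q) = trunc p + trunc q" for p q
    by (simp add: trunc_def lookup_add single_add sum.distrib)
  have trunc_scale: "trunc (Poly_Mapping.map ((*) c) p) = Poly_Mapping.map ((*) c) (trunc p)" for c p
    by (simp add: trunc_def pm.scale_sum_right scale_single del: map_single)
  have "Poly_Mapping.single u 1 \<in> pm.span (trunc ` std_gens s)" if u: "u \<in> D" for u
  proof -
    have "trunc (red_monom u) \<in> pm.span (trunc ` std_gens s)"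
    proof (rule map_span_subset[where f = trunc, OF trunc_add trunc_scale _ red_monom_in_span[OF D(1)[OF u]]])
      fix g assume "g \<in> std_gens s \<union> power_gens s"
      then show "trunc g \<in> pm.span (trunc ` std_gens s)"
      proof
        assume "g \<in> power_gens s"
        then have "order_ge (Msg S) (2 * s) g" by (rule order_ge_power_gens)
        then have "Poly_Mapping.lookup g v = 0" if "v \<in> D" for v
          using D(3)[OF that] by (force simp: order_ge_def in_keys_iff)
        then have "trunc g = 0"
          by (simp add: trunc_def)
        then show ?thesis by (simp add: pm.span_zero)
      qed (simp add: pm.span_base)
    qed
    moreover have "trunc (red_monom u) = Poly_Mapping.single u 1"
    proof -
      have "trunc (red_monom u) = (\<Sum>v\<in>D. if v = u then Poly_Mapping.single u 1 else 0)"
        unfolding trunc_def using D(2)[OF u]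
        by (intro sum.cong) (auto simp: red_monom_def lookup_single when_def)
      then show ?thesis using u finD by simp
    qed
    ultimately show ?thesis by simp
  qed
  moreover have fin_std: "finite (std_gens s)"
    unfolding std_gens_def using apery_finite_card(1) finite_small_multisets[OF fin_R] by simp
  ultimately have "card D \<le> card (trunc ` std_gens s)"
    using finD by (intro card_le_of_singles_in_span) auto
  also have "\<dots> \<le> card (std_gens s)"
    using fin_std by (rule card_image_le)
  also have "\<dots> \<le> card (small_multisets R s \<times> apery)"
    unfolding std_gens_def using apery_finite_card(1) finite_small_multisets[OF fin_R]
    by (intro card_image_le) simp
  also have "\<dots> \<le> card (small_multisets R s) * m"
    using apery_finite_card(2) by (simp add: card_cartesian_product)
  also have "card D = card (small_multisets ?B (2 * s))"
    unfolding D_def by (rule card_image) (auto intro!: inj_onI simp: multiset_eq_iff)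
  finally show ?thesis by (simp add: mult.commute)
qed

lemma generator_ge_two_power:
  assumes "card R = card (Msg S) - 1"
  shows "2 ^ (card (Msg S) - 1) \<le> m"
proof (rule two_power_le_of_binomial_growth)
  fix t
  have "card (Msg S - {m}) = card R"
    using assms m fin by simp
  then show "(card (Msg S) - 1 + (2 * t + 1) choose (card (Msg S) - 1))
      \<le> m * (card (Msg S) - 1 + t choose (card (Msg S) - 1))"
    using card_small_le[of "Suc t"] card_small_multisets[OF fin_R, of t]
      card_small_multisets[of "Msg S - {m}" "2 * t + 1"] fin assms
    by simp
qed

end

lemma multiplicity_ge_two_power:
  assumes "complete_intersection S"
  shows "2 ^ (embedding_dim S - 1) \<le> multiplicity_ns S"
proof -
  obtain R where S: "numerical_semigroup S" and R: "presentation S R" "finite R" "card R \<le> card (Msg S) - 1"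
    using assms by (auto simp: complete_intersection_iff)
  interpret presented_semigroup S R "multiplicity_ns S"
    using S R multiplicity_in_Msg by unfold_locales auto
  have "card R = card (Msg S) - 1"
    using card_Msg_le_presentation[OF S R(1,2)] R(3) by simp
  then show ?thesis
    using generator_ge_two_power by (simp add: embedding_dim_def)
qed

section \<open>Gluing with the natural numbers\<close>

definition glue :: "nat set \<Rightarrow> nat \<Rightarrow> nat \<Rightarrow> nat set" where
  "glue S d c = {d * x + c * j | x j. x \<in> S}"

lemma multiplicity_nsI:
  assumes "x \<in> S" "x > 0" "\<And>y. y \<in> S \<Longrightarrow> y > 0 \<Longrightarrow> x \<le> y"
  shows "multiplicity_ns S = x"
  unfolding multiplicity_ns_def using assms by (intro Least_equality) auto

text \<open>If \<open>c\<close> were a minimal generator of \<open>S\<close>, its renamed copy \<open>d * c\<close> would be a multiple of the new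
  generator \<open>c\<close>, and the embedding dimension would not grow.\<close>

locale gluing =
  fixes S :: "nat set" and d c :: nat
  assumes S: "numerical_semigroup S" and d: "d \<ge> 2" and coprime: "coprime d c"
    and c: "c \<in> S" "c > 0" "c \<notin> Msg S"
begin

lemma submonoid: "add_submonoid S"
  using S by (simp add: numerical_semigroup_def)

lemmas S_closed = add_submonoid_0[OF submonoid] add_submonoid_add[OF submonoid]

lemma d_not_dvd_c: "\<not> d dvd c"
proof
  assume "d dvd c"
  then have "is_unit d" by (rule coprime_common_divisor[OF coprime dvd_refl])
  then show False using d by simp
qed

lemma d_dvd_mult: "d dvd c * j \<Longrightarrow> d dvd j"
  using coprime by (simp add: coprime_dvd_mult_right_iff)

lemma glueI: "x \<in> S \<Longrightarrow> d * x + c * j \<in> glue S d c"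
  by (auto simp: glue_def)

lemma submonoid_glue: "add_submonoid (glue S d c)"
proof (rule add_submonoidI)
  show "0 \<in> glue S d c" using glueI[of 0 0] S_closed by simp
  fix x y assume "x \<in> glue S d c" "y \<in> glue S d c"
  then obtain x' i y' j where "x = d * x' + c * i" "y = d * y' + c * j" "x' \<in> S" "y' \<in> S"
    by (auto simp: glue_def)
  then show "x + y \<in> glue S d c"
    using glueI[of "x' + y'" "i + j"] S_closed by (simp add: algebra_simps)
qed

lemma numerical_semigroup_glue: "numerical_semigroup (glue S d c)"
proof -
  obtain N where N: "\<And>x. x \<ge> N \<Longrightarrow> x \<in> S"
    using numerical_semigroup_eventually[OF S] by metis
  show ?thesis
  proof (rule numerical_semigroupI[OF submonoid_glue])
    fix x assume x: "x \<ge> d * N + c * d"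
    \<comment> \<open>Subtract a multiple of \<open>c\<close> that leaves a multiple of \<open>d\<close>.\<close>
    obtain i0 where "[c * i0 = 1] (mod d)"
      using cong_solve_coprime_nat[of c d] coprime by (auto simp: coprime_commute)
    then have "[c * i0 * x = 1 * x] (mod d)" by (rule cong_scalar_right)
    then obtain i where i: "[c * i = x] (mod d)" by (auto simp: mult.assoc)
    define j where "j = i mod d"
    have "j < d" using d by (simp add: j_def)
    then have le: "c * j \<le> c * d" by simp
    have "(c * j) mod d = x mod d"
      using i by (simp add: j_def cong_def mod_mult_right_eq)
    moreover have "c * j \<le> x" using le x by linarith
    ultimately have "d dvd x - c * j"
      using mod_eq_dvd_iff_nat[of "c * j" x d] by metis
    then obtain y where y: "x - c * j = d * y" by (elim dvdE)
    have "d * N \<le> d * y" using y le x by linarith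
    then have "y \<in> S" using N d by simp
    moreover have "x = d * y + c * j" using y le x by linarith
    ultimately show "x \<in> glue S d c" using glueI by simp
  qed
qed

abbreviation gens :: "nat set" where
  "gens \<equiv> insert c ((*) d ` Msg S)"

lemma fin: "finite (Msg S)" "finite gens"
  using finite_Msg[OF S] by auto

lemma c_notin: "c \<notin> (*) d ` Msg S"
  using d_not_dvd_c by auto

lemma irreducible: "a \<in> Msg S \<Longrightarrow> irreducible_in S a"
  by (rule Msg_irreducible[OF submonoid])

text \<open>The number of copies of \<open>c\<close> in a decomposition is determined modulo \<open>d\<close>. For \<open>c\<close> itself it is
  nonzero, which leaves no room for anything else; for \<open>d * b\<close> with \<open>b\<close> a generator of \<open>S\<close> it is a
  multiple of \<open>d\<close>, so the decomposition can be divided by \<open>d\<close>.\<close>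

lemma irreducible_glue:
  assumes "a \<in> gens" shows "irreducible_in (glue S d c) a"
  unfolding irreducible_in_def
proof (intro conjI ballI impI)
  show "a \<in> glue S d c"
  proof (cases "a = c")
    case True
    then show ?thesis using glueI[of 0 1] S_closed(1) by simp
  next
    case False
    then obtain b where b: "b \<in> Msg S" "a = d * b" using assms by auto
    then have "b \<in> S" using irreducible by (simp add: irreducible_in_def)
    then show ?thesis using glueI[of b 0] b(2) by simp
  qed
  show "a \<noteq> 0"
    using assms c d irreducible by (auto simp: irreducible_in_def)
  fix y z assume "y \<in> glue S d c" "z \<in> glue S d c" and a: "a = y + z"
  then obtain y' i z' j where y: "y = d * y' + c * i" "y' \<in> S" and z: "z = d * z' + c * j" "z' \<in> S"
    by (auto simp: glue_def)
  have sum: "a = d * (y' + z') + c * (i + j)"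
    using a y z by (simp add: algebra_simps)
  show "y = 0 \<or> z = 0"
  proof (cases "a = c")
    case True
    have "i + j \<noteq> 0"
    proof
      assume "i + j = 0"
      then have "c = d * (y' + z')" using sum True by simp
      then show False using d_not_dvd_c by (metis dvd_triv_left)
    qed
    then obtain k where k: "i + j = Suc k" using not0_implies_Suc by blast
    have "c = d * (y' + z') + (c + c * k)"
      using sum True unfolding k by simp
    then have "d * (y' + z') = 0" "c * k = 0" by linarith+
    then have "y' + z' = 0" "i + j = 1" using c(2) d k by simp_all
    then show ?thesis using y z by (cases "i = 0") auto
  next
    case False
    then obtain b where b: "b \<in> Msg S" "a = d * b" using assms by auto
    have "d dvd i + j"
    proof (rule d_dvd_mult)
      have "d dvd d * (y' + z') + c * (i + j)" using sum b(2) by (metis dvd_triv_left)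
      then show "d dvd c * (i + j)" by (metis dvd_add_right_iff dvd_triv_left)
    qed
    then obtain t where t: "i + j = d * t" by (elim dvdE)
    have "d * b = d * (y' + z' + c * t)"
      using sum b t by (simp add: algebra_simps)
    then have bt: "b = y' + z' + c * t" using d by simp
    show ?thesis
    proof (cases t)
      case 0
      then have "i = 0" "j = 0" using t by auto
      moreover have "y' = 0 \<or> z' = 0"
        using irreducible[OF b(1)] bt 0 y z by (auto simp: irreducible_in_def)
      ultimately show ?thesis using y z by auto
    next
      case (Suc t')
      \<comment> \<open>Otherwise \<open>b\<close> exceeds \<open>c\<close> by an element of \<open>S\<close>, so \<open>b = c\<close>.\<close>
      have "y' + z' + c * t' \<in> S"
        using S_closed(2)[OF S_closed(2)[OF y(2) z(2)] add_submonoid_mult[OF submonoid c(1), of t']]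
        by (simp add: mult.commute)
      moreover have "b = (y' + z' + c * t') + c" using bt Suc by simp
      ultimately have "y' + z' + c * t' = 0"
        using irreducible[OF b(1)] c by (auto simp: irreducible_in_def)
      then have "b = c" using \<open>b = (y' + z' + c * t') + c\<close> by simp
      then show ?thesis using b c by simp
    qed
  qed
qed

lemma hull_gens: "add_submonoid hull gens = glue S d c"
proof
  have "gens \<subseteq> glue S d c"
    using irreducible_glue by (auto simp: irreducible_in_def)
  then show "add_submonoid hull gens \<subseteq> glue S d c"
    using submonoid_glue by (rule hull_minimal)
  let ?H = "add_submonoid hull gens"
  have H: "add_submonoid ?H" "gens \<subseteq> ?H"
    using add_submonoid_hull[of gens] hull_subset[of gens add_submonoid] by simp_all
  have "add_submonoid {x. d * x \<in> ?H}"
    using add_submonoid_0[OF H(1)] add_submonoid_add[OF H(1)]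
    by (intro add_submonoidI) (simp_all add: distrib_left)
  moreover have "Msg S \<subseteq> {x. d * x \<in> ?H}"
    using H(2) by auto
  ultimately have "add_submonoid hull Msg S \<subseteq> {x. d * x \<in> ?H}"
    by (intro hull_minimal)
  then have dx: "d * x \<in> ?H" if "x \<in> S" for x
    using that hull_Msg[OF submonoid] by auto
  have cj: "c * j \<in> ?H" for j
    using add_submonoid_mult[OF H(1), of c j] H(2) by (simp add: mult.commute)
  show "glue S d c \<subseteq> ?H"
    using dx cj add_submonoid_add[OF H(1)] by (auto simp: glue_def)
qed

lemma Msg_glue: "Msg (glue S d c) = gens"
  using submonoid_glue hull_gens irreducible_glue by (rule Msg_eqI)

lemma embedding_dim_glue: "embedding_dim (glue S d c) = Suc (embedding_dim S)"
proof -
  have "card ((*) d ` Msg S) = card (Msg S)"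
    using d by (intro card_image) (auto simp: inj_on_def)
  then show ?thesis
    using c_notin fin by (simp add: embedding_dim_def Msg_glue)
qed

lemma multiplicity_glue: "multiplicity_ns (glue S d c) = min (d * multiplicity_ns S) c"
proof (rule multiplicity_nsI)
  note m = multiplicity_ns_Least[OF S]
  show "min (d * multiplicity_ns S) c \<in> glue S d c"
    using glueI[OF m(1), of 0] glueI[of 0 1] S_closed by (simp add: min_def)
  show "min (d * multiplicity_ns S) c > 0"
    using m d c by simp
  fix y assume "y \<in> glue S d c" "y > 0"
  then obtain x j where y: "y = d * x + c * j" "x \<in> S" by (auto simp: glue_def)
  show "min (d * multiplicity_ns S) c \<le> y"
  proof (cases "j = 0")
    case True
    then have "multiplicity_ns S \<le> x" using m(3) y \<open>y > 0\<close> by (cases "x = 0") auto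
    then show ?thesis using y True by (simp add: min.coboundedI1)
  next
    case False
    then have "c * 1 \<le> c * j" by (intro mult_le_mono2) simp
    then have "c \<le> y" using y by linarith
    then show ?thesis by (rule min.coboundedI2)
  qed
qed

text \<open>Exponent vectors for \<open>S\<close> become exponent vectors for the glued semigroup by renaming each
  generator \<open>a\<close> to \<open>d * a\<close>.\<close>

definition lift :: "(nat \<Rightarrow> nat) \<Rightarrow> nat \<Rightarrow> nat" where
  "lift u x = (if d dvd x then u (x div d) else 0)"

lemma lift_add: "lift (u + v) = lift u + lift v"
  by (auto simp: lift_def)

lemma lift_in_expvec: "u \<in> expvec (Msg S) \<Longrightarrow> lift u \<in> expvec gens"
  unfolding expvec_def
proof (intro CollectI allI impI)
  fix x assume u: "u \<in> {u. \<forall>a. a \<notin> Msg S \<longrightarrow> u a = 0}" and x: "x \<notin> gens"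
  show "lift u x = 0"
  proof (cases "d dvd x")
    case True
    then have "x div d \<notin> Msg S" using x by (auto simp: image_iff)
    then show ?thesis using u by (simp add: lift_def)
  qed (simp add: lift_def)
qed

lemma phi_lift: "phi gens (lift u) = d * phi (Msg S) u"
proof -
  have "phi gens (lift u) = (\<Sum>x\<in>(*) d ` Msg S. lift u x * x)"
    using c_notin fin d_not_dvd_c by (simp add: phi_def lift_def)
  also have "\<dots> = (\<Sum>a\<in>Msg S. lift u (d * a) * (d * a))"
    using d by (subst sum.reindex) (auto simp: inj_on_def)
  also have "\<dots> = d * phi (Msg S) u"
    using d by (simp add: lift_def phi_def sum_distrib_left mult_ac)
  finally show ?thesis .
qed

lemma lift_decompose:
  assumes "u \<in> expvec gens"
  obtains v p where "v \<in> expvec (Msg S)" "u = lift v + axis c p"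
proof
  show "(\<lambda>x. u (d * x)) \<in> expvec (Msg S)"
    unfolding expvec_def
  proof (intro CollectI allI impI)
    fix x assume "x \<notin> Msg S"
    then have "d * x \<notin> gens" using d d_not_dvd_c by auto
    then show "u (d * x) = 0" using assms by (simp add: expvec_def)
  qed
  show "u = lift (\<lambda>x. u (d * x)) + axis c (u c)"
    using assms d_not_dvd_c by (auto simp: fun_eq_iff lift_def axis_def expvec_def)
qed

text \<open>A presentation of the glued semigroup consists of the renamed relations of \<open>S\<close> and one relation
  between \<open>d\<close> copies of \<open>c\<close> and the renamed factorization \<open>w\<close> of \<open>c\<close> in \<open>S\<close>. In any relation, the
  numbers of copies of \<open>c\<close> on both sides are congruent modulo \<open>d\<close>; the new relation equalizes them,
  and what remains is a relation of \<open>S\<close>.\<close>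

lemma complete_intersection_glue:
  assumes CI: "complete_intersection S"
  shows "complete_intersection (glue S d c)"
proof -
  obtain R where R: "presentation S R" "finite R" "card R \<le> card (Msg S) - 1"
    using CI by (auto simp: complete_intersection_iff)
  have "c \<in> phi (Msg S) ` expvec (Msg S)"
    using c(1) unfolding hull_eq_phi_image[OF fin(1), symmetric] hull_Msg[OF submonoid] .
  then obtain w where w: "w \<in> expvec (Msg S)" "phi (Msg S) w = c" by auto
  define wt where "wt t x = t * w x" for t x
  have wt: "wt t \<in> expvec (Msg S)" "phi (Msg S) (wt t) = c * t" for t
    using w by (auto simp: wt_def expvec_def phi_def sum_distrib_left sum_distrib_right mult_ac)
  have wt_Suc: "wt (Suc t) = w + wt t" and wt_0: "wt 0 = 0" for t
    by (auto simp: wt_def fun_eq_iff)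
  have lift0: "lift 0 = 0" and axis0: "axis c 0 = 0" and axis_add: "axis c (p + q) = axis c p + axis c q" for p q
    by (auto simp: lift_def axis_def fun_eq_iff)
  have ax: "axis c p \<in> expvec gens" "phi gens (axis c p) = p * c" for p
    using fin(2) by (auto intro: axis_in_expvec simp: phi_axis)
  define R' where "R' = insert (axis c d, lift w) ((\<lambda>(u, v). (lift u, lift v)) ` R)"
  have "presentation (glue S d c) R'"
  proof (rule presentationI; unfold Msg_glue)
    show "R' \<subseteq> relations gens"
      unfolding R'_def
    proof (rule insert_subsetI)
      show "(axis c d, lift w) \<in> relations gens"
        using w(1) ax by (simp add: relations_def lift_in_expvec phi_lift w(2))
      show "(\<lambda>(u, v). (lift u, lift v)) ` R \<subseteq> relations gens"
      proof (rule image_subsetI)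
        fix \<rho> assume "\<rho> \<in> R"
        then have "\<rho> \<in> relations (Msg S)" using R(1) by (auto simp: presentation_def)
        then show "(case \<rho> of (u, v) \<Rightarrow> (lift u, lift v)) \<in> relations gens"
          by (cases \<rho>) (simp add: relations_def lift_in_expvec phi_lift)
      qed
    qed
    fix C assume C: "congruence gens C" "R' \<subseteq> C"
    have eq: "equiv (expvec gens) C" and plus: "\<And>u v u' v'. (u, v) \<in> C \<Longrightarrow> (u', v') \<in> C \<Longrightarrow> (u + u', v + v') \<in> C"
      using C(1) by (auto simp: congruence_def)
    have refl: "(u, u) \<in> C" if "u \<in> expvec gens" for u
      using eq that by (auto simp: equiv_def refl_on_def)
    have sym: "(v, u) \<in> C" if "(u, v) \<in> C" for u v
      using eq that by (auto simp: equiv_def dest: symD)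
    have trans: "(u, x) \<in> C" if "(u, v) \<in> C" "(v, x) \<in> C" for u v x
      using eq that by (auto simp: equiv_def dest: transD)
    \<comment> \<open>Pull \<open>C\<close> back to the exponent vectors for \<open>S\<close>.\<close>
    define C0 where "C0 = {(u, v). u \<in> expvec (Msg S) \<and> v \<in> expvec (Msg S) \<and> (lift u, lift v) \<in> C}"
    have "congruence (Msg S) C0"
    proof (intro congruenceI equivI)
      show "C0 \<subseteq> expvec (Msg S) \<times> expvec (Msg S)" by (auto simp: C0_def)
      show "refl_on (expvec (Msg S)) C0"
        by (rule refl_onI) (auto simp: C0_def lift_in_expvec refl)
      show "sym C0" by (rule symI) (auto simp: C0_def sym)
      show "trans C0" by (rule transI) (auto simp: C0_def intro: trans)
      show "(u + u', v + v') \<in> C0" if "(u, v) \<in> C0" "(u', v') \<in> C0" for u v u' v'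
        using that by (auto simp: C0_def lift_add add_in_expvec plus)
    qed
    moreover have "R \<subseteq> C0"
      using C(2) R(1) by (auto simp: R'_def C0_def presentation_def relations_def)
    ultimately have rel: "relations (Msg S) \<subseteq> C0"
      using presentation_subset_congruence[OF R(1)] by simp
    \<comment> \<open>The new relation, applied \<open>t\<close> times; \<open>wt t\<close> is the \<open>t\<close>-fold multiple of \<open>w\<close>.\<close>
    have replace: "(axis c (d * t), lift (wt t)) \<in> C" for t
    proof (induction t)
      case 0
      show ?case using refl[OF zero_in_expvec] by (simp only: axis0 wt_0 lift0 mult_0_right)
    next
      case (Suc t)
      have "(axis c d + axis c (d * t), lift w + lift (wt t)) \<in> C"
        using Suc C(2) by (intro plus) (auto simp: R'_def)
      then show ?case
        by (simp only: wt_Suc lift_add axis_add mult_Suc_right)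
    qed
    have ordered: "(lift u + axis c p, lift v + axis c q) \<in> C"
      if u: "u \<in> expvec (Msg S)" and v: "v \<in> expvec (Msg S)" and "p \<le> q"
        and eq: "d * phi (Msg S) u + p * c = d * phi (Msg S) v + q * c" for u v p q
    proof -
      have diff: "d * phi (Msg S) u = d * phi (Msg S) v + c * (q - p)"
        using eq \<open>p \<le> q\<close> by (simp add: diff_mult_distrib2 mult.commute)
      have "d dvd q - p"
      proof (rule d_dvd_mult)
        have "d dvd d * phi (Msg S) v + c * (q - p)"
          unfolding diff[symmetric] by (rule dvd_triv_left)
        then show "d dvd c * (q - p)"
          using dvd_add_right_iff[of d "d * phi (Msg S) v" "c * (q - p)"] dvd_triv_left by blast
      qed
      then obtain t where t: "q - p = d * t" by (elim dvdE)
      have "d * phi (Msg S) u = d * (phi (Msg S) v + c * t)"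
        using diff t by (simp add: algebra_simps)
      then have "phi (Msg S) u = phi (Msg S) (v + wt t)"
        using d by (simp add: phi_add wt)
      then have "(u, v + wt t) \<in> relations (Msg S)"
        using u v wt(1) by (simp add: relations_def add_in_expvec)
      then have "(lift u, lift (v + wt t)) \<in> C"
        using rel by (auto simp: C0_def)
      then have "(lift u + axis c p, lift (v + wt t) + axis c p) \<in> C"
        using plus refl ax by blast
      moreover have "(lift v + axis c p) + lift (wt t) = lift (v + wt t) + axis c p"
        by (simp only: lift_add add_ac)
      moreover have "((lift v + axis c p) + axis c (d * t), (lift v + axis c p) + lift (wt t)) \<in> C"
        using plus refl replace ax v lift_in_expvec add_in_expvec by metis
      moreover have "(lift v + axis c p) + axis c (d * t) = lift v + axis c q"
      proof -
        have "q = p + d * t" using t \<open>p \<le> q\<close> by linarith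
        then show ?thesis by (simp only: axis_add add.assoc)
      qed
      ultimately show ?thesis
        using trans sym by metis
    qed
    show "relations gens \<subseteq> C"
    proof (rule subrelI)
      fix u v assume uv: "(u, v) \<in> relations gens"
      obtain u' p where u': "u' \<in> expvec (Msg S)" "u = lift u' + axis c p"
        using uv lift_decompose[of u] by (auto simp: relations_def)
      obtain v' q where v': "v' \<in> expvec (Msg S)" "v = lift v' + axis c q"
        using uv lift_decompose[of v] by (auto simp: relations_def)
      have "d * phi (Msg S) u' + p * c = d * phi (Msg S) v' + q * c"
        using uv u' v' by (simp add: relations_def phi_add phi_lift ax)
      then show "(u, v) \<in> C"
        using ordered[OF u'(1) v'(1)] sym[OF ordered[OF v'(1) u'(1)]] u'(2) v'(2)
        by (cases "p \<le> q") simp_all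
    qed
  qed
  moreover have "finite R'" using R(2) by (simp add: R'_def)
  moreover have "card R' \<le> card (Msg (glue S d c)) - 1"
  proof -
    have "Msg S \<noteq> {}" using multiplicity_in_Msg[OF S] by auto
    then have "card (Msg S) > 0" using fin by (simp add: card_gt_0_iff)
    have "card R' \<le> Suc (card ((\<lambda>(u, v). (lift u, lift v)) ` R))"
      unfolding R'_def by (rule card_insert_le_m1) auto
    also have "\<dots> \<le> Suc (card R)" using card_image_le[OF R(2)] by simp
    also have "\<dots> \<le> card (Msg S)" using R(3) \<open>card (Msg S) > 0\<close> by simp
    finally show ?thesis
      using embedding_dim_glue by (simp add: embedding_dim_def)
  qed
  ultimately show ?thesis
    using numerical_semigroup_glue by (auto simp: complete_intersection_iff)
qed

end

section \<open>Existence\<close>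

lemma Msg_UNIV: "Msg UNIV = {1}"
proof (rule Msg_eqI)
  show "add_submonoid UNIV" by (simp add: add_submonoid_def)
  have "n \<in> add_submonoid hull {1}" for n
    using add_submonoid_mult[OF add_submonoid_hull[of "{1}"], of 1 n] hull_subset[of "{1}" add_submonoid]
    by simp
  then show "add_submonoid hull {1} = UNIV" by auto
qed (auto simp: irreducible_in_def)

lemma UNIV_complete_intersection:
  "complete_intersection UNIV" "embedding_dim UNIV = 1" "multiplicity_ns UNIV = 1"
proof -
  show "embedding_dim UNIV = 1" by (simp add: embedding_dim_def Msg_UNIV)
  show "multiplicity_ns UNIV = 1" by (rule multiplicity_nsI) auto
  have "presentation UNIV {}"
  proof (rule presentationI)
    fix C assume "congruence (Msg UNIV) C"
    then have refl: "(u, u) \<in> C" if "u \<in> expvec (Msg UNIV)" for u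
      using that by (auto simp: congruence_def equiv_def refl_on_def)
    show "relations (Msg UNIV) \<subseteq> C"
    proof (rule subrelI)
      fix u v assume uv: "(u, v) \<in> relations (Msg UNIV)"
      then have "u x = v x" for x
        by (cases "x = 1") (auto simp: relations_def phi_def expvec_def Msg_UNIV)
      then have "u = v" by (simp add: fun_eq_iff)
      then show "(u, v) \<in> C" using uv refl by (auto simp: relations_def)
    qed
  qed simp
  then show "complete_intersection UNIV"
    by (auto simp: complete_intersection_iff numerical_semigroup_def add_submonoid_def
        intro!: exI[of _ "{}"])
qed

text \<open>The step glues with \<open>d = 2\<close> and an odd \<open>c \<ge> 2 ^ Suc k\<close>, which doubles the multiplicity. The
  statement carries a prescribed non-generator \<open>M\<close> because gluing needs one: if \<open>M\<close> is even, it comes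
  from \<open>M / 2\<close> and any large odd \<open>c\<close> will do; if \<open>M\<close> is odd, \<open>c = M - 2 ^ Suc k\<close> is itself the
  non-generator prescribed for \<open>S\<close>, and \<open>M\<close> is the sum of the generators \<open>2 ^ Suc k\<close> and \<open>c\<close>.\<close>

lemma ex_complete_intersection_two_power:
  assumes "2 ^ Suc k \<le> M"
  shows "\<exists>S. complete_intersection S \<and> embedding_dim S = Suc k \<and> multiplicity_ns S = 2 ^ k \<and>
    M \<in> S \<and> M \<notin> Msg S"
  using assms
proof (induction k arbitrary: M)
  case 0
  then show ?case
    using UNIV_complete_intersection by (intro exI[of _ UNIV]) (auto simp: Msg_UNIV)
next
  case (Suc k)
  show ?case
  proof (cases "even M")
    case True
    then obtain N where N: "M = 2 * N" by (elim evenE)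
    with Suc.prems have "2 ^ Suc k \<le> N" by simp
    from Suc.IH[OF this] obtain S where S: "complete_intersection S" "embedding_dim S = Suc k"
      "multiplicity_ns S = 2 ^ k" "N \<in> S" "N \<notin> Msg S" by blast
    have ns: "numerical_semigroup S" using S(1) by (simp add: complete_intersection_def)
    obtain K where K: "\<And>x. x \<ge> K \<Longrightarrow> x \<in> S"
      using numerical_semigroup_eventually[OF ns] by metis
    obtain L where L: "\<And>a. a \<in> Msg S \<Longrightarrow> a < L"
      using finite_Msg[OF ns] finite_nat_set_iff_bounded by metis
    define c where "c = 2 * (K + L + 2 ^ k) + 1"
    interpret g: gluing S 2 c
    proof
      show "c \<in> S" by (rule K) (simp add: c_def)
      show "c \<notin> Msg S" using L[of c] by (auto simp: c_def)
    qed (use ns in \<open>auto simp: c_def\<close>)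
    have "M \<in> glue S 2 c" using g.glueI[OF S(4), of 0] N by simp
    moreover have "M \<notin> Msg (glue S 2 c)"
    proof -
      have "odd c" by (simp add: c_def)
      then have "M \<noteq> c" using True by blast
      then show ?thesis unfolding g.Msg_glue using N S(5) by auto
    qed
    moreover have "multiplicity_ns (glue S 2 c) = 2 ^ Suc k"
      unfolding g.multiplicity_glue using S(3) by (simp add: c_def)
    ultimately show ?thesis
      using g.complete_intersection_glue[OF S(1)] g.embedding_dim_glue S(2) by auto
  next
    case False
    define c where "c = M - 2 ^ Suc k"
    have c: "M = 2 ^ Suc k + c" "2 ^ Suc k \<le> c" using Suc.prems by (auto simp: c_def)
    with False have "odd c" by auto
    from Suc.IH[OF c(2)] obtain S where S: "complete_intersection S" "embedding_dim S = Suc k"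
      "multiplicity_ns S = 2 ^ k" "c \<in> S" "c \<notin> Msg S" by blast
    have ns: "numerical_semigroup S" using S(1) by (simp add: complete_intersection_def)
    have "2 ^ k \<in> S" using multiplicity_ns_Least(1)[OF ns] S(3) by simp
    interpret g: gluing S 2 c
      by unfold_locales (use ns S \<open>odd c\<close> in \<open>auto simp: odd_pos\<close>)
    have "M \<in> glue S 2 c" using g.glueI[OF \<open>2 ^ k \<in> S\<close>, of 1] c(1) by simp
    moreover have "M \<notin> Msg (glue S 2 c)"
    proof -
      have "M \<noteq> c" using c(1) by simp
      then show ?thesis unfolding g.Msg_glue using False by auto
    qed
    moreover have "multiplicity_ns (glue S 2 c) = 2 ^ Suc k"
      unfolding g.multiplicity_glue using S(3) c(2) by simp
    ultimately show ?thesis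
      using g.complete_intersection_glue[OF S(1)] g.embedding_dim_glue S(2) by auto
  qed
qed

lemma ex_complete_intersection:
  assumes "e \<ge> 2" "2 ^ (e - 1) \<le> m"
  shows "\<exists>S. complete_intersection S \<and> embedding_dim S = e \<and> multiplicity_ns S = m"
proof -
  define k where "k = e - 2"
  then have k: "e = Suc (Suc k)" using assms(1) by simp
  then have "2 ^ Suc k \<le> m" using assms by simp
  from ex_complete_intersection_two_power[OF this] obtain S where
    S: "complete_intersection S" "embedding_dim S = Suc k" "multiplicity_ns S = 2 ^ k" "m \<in> S" "m \<notin> Msg S"
    by blast
  have "m > 0" using \<open>2 ^ Suc k \<le> m\<close> by (rule less_le_trans[rotated]) simp
  \<comment> \<open>Any multiplier prime to \<open>m\<close> and at least \<open>m / 2 ^ k\<close> makes \<open>m\<close> the smallest generator.\<close>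
  interpret g: gluing S "m + 1" m
    by unfold_locales (use S \<open>m > 0\<close> in \<open>auto simp: complete_intersection_def\<close>)
  have "m \<le> (m + 1) * 2 ^ k"
    by (rule order.trans[of _ "(m + 1) * 1"], simp, intro mult_le_mono2) simp
  then have "multiplicity_ns (glue S (m + 1) m) = m"
    unfolding g.multiplicity_glue using S(3) by simp
  then show ?thesis
    using g.complete_intersection_glue[OF S(1)] g.embedding_dim_glue S(2) k by auto
qed

lemma embedding_dim_pos:
  assumes "numerical_semigroup S" shows "embedding_dim S > 0"
  using multiplicity_in_Msg[OF assms] finite_Msg[OF assms] by (auto simp: embedding_dim_def card_gt_0_iff)

text \<open>All elements are multiples of the only generator, but two consecutive integers occur.\<close>

lemma embedding_dim_1:
  assumes "numerical_semigroup S" "embedding_dim S = 1" shows "multiplicity_ns S = 1"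
proof -
  let ?m = "multiplicity_ns S"
  have "Msg S = {?m}"
    using assms multiplicity_in_Msg[OF assms(1)] by (auto simp: embedding_dim_def card_1_singleton_iff)
  then have "add_submonoid hull {?m} = S"
    using hull_Msg[of S] assms(1) by (simp add: numerical_semigroup_def)
  moreover have "add_submonoid {x. ?m dvd x}" by (simp add: add_submonoid_def)
  ultimately have dvd: "?m dvd x" if "x \<in> S" for x
    using that hull_minimal[of "{?m}" "{x. ?m dvd x}" add_submonoid] by auto
  obtain N where N: "\<And>x. x \<ge> N \<Longrightarrow> x \<in> S"
    using numerical_semigroup_eventually[OF assms(1)] by metis
  have "?m dvd N" "?m dvd N + 1" using dvd N by auto
  then show ?thesis by (metis dvd_add_right_iff nat_dvd_1_iff_1)
qed

theorem theorem1p4: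
  shows "(\<forall>e m :: nat. e > 0 \<longrightarrow> m > 0 \<longrightarrow>
            ((\<exists>\<Gamma>. complete_intersection \<Gamma> \<and> embedding_dim \<Gamma> = e \<and> multiplicity_ns \<Gamma> = m)
              \<longleftrightarrow> (e, m) = (1, 1) \<or> (e \<ge> 2 \<and> m \<ge> 2 ^ (e - 1))))
       \<and> {(int (embedding_dim \<Gamma>), int (multiplicity_ns \<Gamma>)) | \<Gamma>. complete_intersection \<Gamma>}
           = {(1, 1)} \<union> {(e :: int, m :: int). e \<ge> 2 \<and> m \<ge> 2 ^ nat (e - 1)}"
proof -
  define Q :: "nat \<Rightarrow> nat \<Rightarrow> bool" where "Q e m \<longleftrightarrow> (e, m) = (1, 1) \<or> (e \<ge> 2 \<and> m \<ge> 2 ^ (e - 1))" for e m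
  have necessary: "Q (embedding_dim \<Gamma>) (multiplicity_ns \<Gamma>)" if CI: "complete_intersection \<Gamma>" for \<Gamma>
  proof -
    have ns: "numerical_semigroup \<Gamma>" using CI by (simp add: complete_intersection_def)
    show ?thesis
      using embedding_dim_pos[OF ns] embedding_dim_1[OF ns] multiplicity_ge_two_power[OF CI]
      by (cases "embedding_dim \<Gamma> = 1") (auto simp: Q_def)
  qed
  have sufficient: "\<exists>\<Gamma>. complete_intersection \<Gamma> \<and> embedding_dim \<Gamma> = e \<and> multiplicity_ns \<Gamma> = m"
    if "Q e m" for e m
    using that UNIV_complete_intersection ex_complete_intersection by (auto simp: Q_def)
  have iff: "(\<exists>\<Gamma>. complete_intersection \<Gamma> \<and> embedding_dim \<Gamma> = e \<and> multiplicity_ns \<Gamma> = m) \<longleftrightarrow> Q e m" for e m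
    using necessary sufficient by blast
  have int_Q: "(int e, int m) \<in> {(1, 1)} \<union> {(e :: int, m :: int). e \<ge> 2 \<and> m \<ge> 2 ^ nat (e - 1)} \<longleftrightarrow> Q e m"
    for e m
  proof -
    have "nat (int e - 1) = e - 1" by simp
    moreover have "(2 ^ (e - 1) \<le> int m) = (2 ^ (e - 1) \<le> m)"
      by (metis of_nat_le_iff of_nat_numeral of_nat_power)
    ultimately show ?thesis by (auto simp: Q_def)
  qed
  have "{(int (embedding_dim \<Gamma>), int (multiplicity_ns \<Gamma>)) | \<Gamma>. complete_intersection \<Gamma>}
      = {(int e, int m) | e m. Q e m}"
    by (auto simp flip: iff)
  also have "\<dots> = {(1, 1)} \<union> {(e :: int, m :: int). e \<ge> 2 \<and> m \<ge> 2 ^ nat (e - 1)}"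
  proof (intro subset_antisym subsetI)
    fix p assume "p \<in> {(int e, int m) | e m. Q e m}"
    then show "p \<in> {(1, 1)} \<union> {(e :: int, m :: int). e \<ge> 2 \<and> m \<ge> 2 ^ nat (e - 1)}"
      using int_Q by blast
  next
    fix p :: "int \<times> int"
    assume p: "p \<in> {(1, 1)} \<union> {(e :: int, m :: int). e \<ge> 2 \<and> m \<ge> 2 ^ nat (e - 1)}"
    have "fst p \<ge> 0 \<and> snd p \<ge> 0"
    proof (cases "p = (1, 1)")
      case False
      then have "fst p \<ge> 2" "snd p \<ge> 2 ^ nat (fst p - 1)" using p by auto
      moreover have "(0::int) \<le> 2 ^ nat (fst p - 1)" by simp
      ultimately show ?thesis by linarith
    qed simp
    then obtain e m where "p = (int e, int m)"
      by (metis prod.collapse zero_le_imp_eq_int)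
    then show "p \<in> {(int e, int m) | e m. Q e m}" using p int_Q by blast
  qed
  finally show ?thesis
    using iff by (simp add: Q_def)
qed

end
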